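(* Let $d_X,d_Z\in\mathbb N$, $d:=d_X+d_Z$, $s>0$, $C\ge1$, $c\in(0,1]$, $\delta\in(0,2]$, $\alpha\in(0,1/2)$. For a distribution $P$ of $(X,Y,Z)$ on $[0,1]^{d_X}\times\mathbb{R}\times[0,1]^{d_Z}$ write $g_P(x,z):=\mathbb{E}_P(Y\mid X=x,Z=z)$, $m_P(z):=\mathbb{E}_P(Y\mid Z=z)$, $\varepsilon_P:=Y-m_P(Z)$ and $\tau_P:=\mathbb{E}_P[\{g_P(X,Z)-m_P(Z)\}^2]$. Let $\mathcal{P}$ be the class of all such distributions satisfying: (a) $\mathbb{E}_P(\varepsilon_P^2\mid X,Z)\ge c$ and $\mathbb{E}_P(|\varepsilon_P|^{2+\delta}\mid X,Z)\le C$; (b) $(X,Z)$ has a density $p_P$ with respect to Lebesgue measure on $[0,1]^d$ with $c\le p_P(x,z)\le C$ for all $(x,z)\in[0,1]^d$; (c) the conditional density $p_{X|Z,P}$ of $X$ given $Z$ satisfies $p_{X|Z,P}(x\mid\cdot)\in\mathcal{H}_s^{d_Z}$ for all $x\in[0,1]^{d_X}$, and $m_P\in\mathcal{H}_s^{d_Z}$, $g_P\in\mathcal{H}_s^{d}$, with $\max\bigl\{\sup_{x}\|p_{X|Z,P}(x\mid\cdot)\|_{\mathcal{H}_s},\|m_P\|_{\mathcal{H}_s},\|g_P\|_{\mathcal{H}_s}\bigr\}\le C$. For a positive sequence $(\epsilon_n)$ let $\mathcal{P}_1(\epsilon_n):=\{P\in\mathcal{P}:\tau_P\ge\epsilon_n\}$.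 Then there exists $c'>0$ such that, if $\limsup_{n\to\infty}\epsilon_n\cdot n^{\frac{4s}{4s+d}}<c'$, any test $\phi$ having uniform asymptotic size at most $\alpha$ satisfies $$\limsup_{n\to\infty}\inf_{P\in\mathcal{P}_1(\epsilon_n)}\mathbb{P}_P(\phi=1)\le\alpha+\tfrac12.$$
   Context: A test $\phi=\phi_n$ is a sequence of measurable $\{0,1\}$-valued functions of $n$ i.i.d. observations of $(X,Y,Z)$ with law $P$. It has uniform asymptotic size at most $\alpha$ if $\limsup_{n\to\infty}\sup_{P\in\mathcal P:\tau_P=0}\mathbb P_P(\phi=1)\le\alpha$. Conditional inequalities hold almost surely. Hölder spaces: for $s>0$ and $s_0:=\lceil s\rceil-1$, $\mathcal H_s^{q}$ is the set of $s_0$-times differentiable $f:[0,1]^q\to\mathbb R$ for which there is $B>0$ with $\max_{|\boldsymbol\alpha|=s_0}|D^{\boldsymbol\alpha}f(x)-D^{\boldsymbol\alpha}f(\tilde x)|\le B\|x-\tilde x\|_2^{s-s_0}$ for all $x,\tilde x\in[0,1]^q$ and $\max_{|\boldsymbol\alpha|=s_0}\|D^{\boldsymbol\alpha}f\|_\infty\le B$ (maxima over multi-indices); $\|f\|_{\mathcal H_s}$ is the infimum of such $B$. *)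

theory Defs
  imports "HOL-Probability.Probability"
begin

section \<open>Hoelder spaces on the unit cube\<close>

text \<open>
  A function on $[0,1]^q$ is represented by a total function on a Euclidean space of dimension $q$.
  All derivatives are taken within the cube, so its values outside the cube are irrelevant. On a
  product type both the norm and the cube are those of the concatenated vector.
\<close>

definition unit_cube :: "'a::euclidean_space set" where
  "unit_cube = cbox 0 One"

definition partial_deriv :: "'a::euclidean_space \<Rightarrow> ('a \<Rightarrow> real) \<Rightarrow> 'a \<Rightarrow> real" where
  "partial_deriv b f x = frechet_derivative f (at x within unit_cube) b"

primrec times_differentiable :: "nat \<Rightarrow> ('a::euclidean_space \<Rightarrow> real) \<Rightarrow> bool" where
  "times_differentiable 0 f \<longleftrightarrow> True"
| "times_differentiable (Suc k) f \<longleftrightarrow>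
     f differentiable_on unit_cube \<and> (\<forall>b\<in>Basis. times_differentiable k (partial_deriv b f))"

text \<open>
  A multi-index is a function on the basis vectors. The derivative $D^a f$ applies the partial
  derivatives in the order of some fixed enumeration of the basis; for an $|a|$ times
  (Frechet) differentiable function the order does not matter.
\<close>

definition basis_list :: "'a::euclidean_space list" where
  "basis_list = (SOME bs. distinct bs \<and> set bs = Basis)"

definition multi_deriv :: "('a::euclidean_space \<Rightarrow> nat) \<Rightarrow> ('a \<Rightarrow> real) \<Rightarrow> 'a \<Rightarrow> real" where
  "multi_deriv a f = fold (\<lambda>b. partial_deriv b ^^ a b) basis_list f"

definition holder_order :: "real \<Rightarrow> nat" where
  "holder_order s = nat (\<lceil>s\<rceil> - 1)"

definition holder_bound :: "real \<Rightarrow> ('a::euclidean_space \<Rightarrow> real) \<Rightarrow> real \<Rightarrow> bool" where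
  "holder_bound s f B \<longleftrightarrow> B > 0 \<and>
     (\<forall>a. (\<Sum>b\<in>Basis. a b) = holder_order s \<longrightarrow>
        (\<forall>x\<in>unit_cube. \<forall>x'\<in>unit_cube.
           \<bar>multi_deriv a f x - multi_deriv a f x'\<bar> \<le> B * norm (x - x') powr (s - real (holder_order s))) \<and>
        (\<forall>x\<in>unit_cube. \<bar>multi_deriv a f x\<bar> \<le> B))"

definition holder_space :: "real \<Rightarrow> ('a::euclidean_space \<Rightarrow> real) set" where
  "holder_space s = {f. times_differentiable (holder_order s) f \<and> (\<exists>B. holder_bound s f B)}"

definition holder_norm :: "real \<Rightarrow> ('a::euclidean_space \<Rightarrow> real) \<Rightarrow> real" where
  "holder_norm s f = Inf {B. holder_bound s f B}"

section \<open>The statistical model\<close>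

text \<open>
  An observation is a triple $(x,y,z)$, and a distribution is a Borel probability measure on the
  ambient space; that it lives on $[0,1]^{d_X} \times R \times [0,1]^{d_Z}$ is imposed in the
  definition of the model class.
\<close>

type_synonym ('dx, 'dz) obs = "(real ^ 'dx) \<times> real \<times> (real ^ 'dz)"

definition obs_Y :: "('dx::finite, 'dz::finite) obs \<Rightarrow> real" where
  "obs_Y w = fst (snd w)"

definition obs_Z :: "('dx::finite, 'dz::finite) obs \<Rightarrow> real ^ 'dz" where
  "obs_Z w = snd (snd w)"

definition obs_XZ :: "('dx::finite, 'dz::finite) obs \<Rightarrow> (real ^ 'dx) \<times> (real ^ 'dz)" where
  "obs_XZ w = (fst w, snd (snd w))"

definition gen_sigma :: "'a measure \<Rightarrow> ('a \<Rightarrow> 'b::topological_space) \<Rightarrow> 'a measure" where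
  "gen_sigma P W = vimage_algebra (space P) W borel"

definition cond_mean_version ::
  "('dx::finite, 'dz::finite) obs measure \<Rightarrow> (('dx, 'dz) obs \<Rightarrow> 'b::topological_space) \<Rightarrow> ('b \<Rightarrow> real) \<Rightarrow> bool"
where
  "cond_mean_version P W f \<longleftrightarrow> f \<in> borel_measurable borel \<and>
     (AE w in P. real_cond_exp P (gen_sigma P W) obs_Y w = f (W w))"

definition tau :: "('dx::finite, 'dz::finite) obs measure \<Rightarrow> real" where
  "tau P = (\<integral>w. (real_cond_exp P (gen_sigma P obs_XZ) obs_Y w
                - real_cond_exp P (gen_sigma P obs_Z) obs_Y w)\<^sup>2 \<partial>P)"

text \<open>
  The densities and conditional means are determined by the distribution only up to null sets;
  membership in the class requires versions satisfying the pointwise and smoothness conditions.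
  The conditional moments use the extended nonnegative conditional expectation, because the
  real-valued one takes the junk value 0 where the conditional moment is infinite.
\<close>

definition model_class ::
  "real \<Rightarrow> real \<Rightarrow> real \<Rightarrow> real \<Rightarrow> ('dx::finite, 'dz::finite) obs measure set"
where
  "model_class s C c \<delta> = {P. prob_space P \<and> sets P = sets borel \<and>
     (AE w in P. obs_XZ w \<in> unit_cube) \<and> integrable P obs_Y \<and>
     (\<exists>(p :: (real ^ 'dx) \<times> (real ^ 'dz) \<Rightarrow> real) (m :: real ^ 'dz \<Rightarrow> real)
       (g :: (real ^ 'dx) \<times> (real ^ 'dz) \<Rightarrow> real).
        cond_mean_version P obs_Z m \<and> cond_mean_version P obs_XZ g \<and>
        (AE w in P. nn_cond_exp P (gen_sigma P obs_XZ)
           (\<lambda>w. ennreal ((obs_Y w - m (obs_Z w))\<^sup>2)) w \<ge> ennreal c) \<and>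
        (AE w in P. nn_cond_exp P (gen_sigma P obs_XZ)
           (\<lambda>w. ennreal (\<bar>obs_Y w - m (obs_Z w)\<bar> powr (2 + \<delta>))) w \<le> ennreal C) \<and>
        distributed P lborel obs_XZ (\<lambda>v. ennreal (p v) * indicator unit_cube v) \<and>
        (\<forall>v\<in>unit_cube. c \<le> p v \<and> p v \<le> C) \<and>
        (\<forall>x\<in>unit_cube.
           (\<lambda>z. p (x, z) / (LINT x':unit_cube|lborel. p (x', z))) \<in> holder_space s \<and>
           holder_norm s (\<lambda>z. p (x, z) / (LINT x':unit_cube|lborel. p (x', z))) \<le> C) \<and>
        m \<in> holder_space s \<and> holder_norm s m \<le> C \<and>
        g \<in> holder_space s \<and> holder_norm s g \<le> C)}"

definition alternatives ::
  "real \<Rightarrow> real \<Rightarrow> real \<Rightarrow> real \<Rightarrow> real \<Rightarrow> ('dx::finite, 'dz::finite) obs measure set"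
where
  "alternatives s C c \<delta> e = {P \<in> model_class s C c \<delta>. tau P \<ge> e}"

section \<open>Tests\<close>

text \<open>The sample of size $n$ is indexed by $\{0,\dots,n-1\}$; its law is the $n$-fold product.\<close>

definition is_test :: "(nat \<Rightarrow> (nat \<Rightarrow> ('dx::finite, 'dz::finite) obs) \<Rightarrow> nat) \<Rightarrow> bool" where
  "is_test \<phi> \<longleftrightarrow> (\<forall>n. \<phi> n \<in> Pi\<^sub>M {..<n} (\<lambda>_. borel) \<rightarrow>\<^sub>M count_space {0, 1})"

definition rejection_prob ::
  "('dx::finite, 'dz::finite) obs measure \<Rightarrow> nat \<Rightarrow> ((nat \<Rightarrow> ('dx, 'dz) obs) \<Rightarrow> nat) \<Rightarrow> real"
where
  "rejection_prob P n f =
     measure (Pi\<^sub>M {..<n} (\<lambda>_. P)) {\<omega> \<in> space (Pi\<^sub>M {..<n} (\<lambda>_. P)). f \<omega> = 1}"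

definition uniform_asymptotic_size_le ::
  "('dx::finite, 'dz::finite) obs measure set \<Rightarrow> (nat \<Rightarrow> (nat \<Rightarrow> ('dx, 'dz) obs) \<Rightarrow> nat) \<Rightarrow> real \<Rightarrow> bool"
where
  "uniform_asymptotic_size_le \<P> \<phi> \<alpha> \<longleftrightarrow>
     limsup (\<lambda>n. SUP P\<in>{P \<in> \<P>. tau P = 0}. ereal (rejection_prob P n (\<phi> n))) \<le> ereal \<alpha>"

end

theory Submission
  imports Defs "HOL-Computational_Algebra.Polynomial"
begin

text \<open>
  The lower bound is Ingster's: a simple null is compared with a mixture of alternatives. Under
  the null, \<open>(X, Z)\<close> is uniform on the cube and \<open>Y\<close> is an independent fair sign. An
  alternative tilts the density by \<open>1 + y h(x, z)\<close>, which keeps \<open>(X, Z)\<close> uniform and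
  \<open>\<bar>Y\<bar> = 1\<close>, so that all moment conditions hold with the constant 1, and makes \<open>h\<close> the
  regression function. Here \<open>h\<close> is a sum over the \<open>k\<^sup>d\<close> cells of a grid of mesh \<open>1/k\<close> of bumps
  of height of order \<open>k\<close> to the power \<open>-s\<close>, with arbitrary signs. The bumps are products of
  one-dimensional bumps of integral zero, hence \<open>E(Y | Z) = 0\<close> and \<open>\<tau> = \<integral>h\<^sup>2\<close>.
  Averaging over the signs, the second moment of the likelihood ratio is at most
  \<open>exp(N \<theta>\<^sup>2)\<close> with \<open>N = k\<^sup>d\<close> and \<open>\<theta> = n \<integral>h\<^sup>2 / N\<close>; this stays close to 1 when \<open>k\<close> is of order
  \<open>n\<close> to the power \<open>2/(4s+d)\<close>.
\<close>

section \<open>A smooth bump of integral zero\<close>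

text \<open>One fixed alternative would not give the rate: against a known \<open>h\<close> the
  likelihood ratio test already detects \<tau> of order 1/n. With unknown signs the terms linear in
  \<open>h\<close> average out, and two sign patterns interact only through the integral of
  \<open>h * h'\<close>, which is \<mu> = \<tau>/N times a sum of N signs. Its exponential moment is
  what leaves N \<theta>^2 with \<theta> = n \<mu>. Smoothness limits the bumps to height k^(-s), so
  \<tau> is of order k^(-2s), \<mu> of order k^(-2s-d), and N \<theta>^2 of order n^2 k^(-4s-d).
  Keeping this bounded dictates the mesh, and k^(-2s) then becomes the rate n^(-4s/(4s+d)).

  The additive 1/2 is 1/4 + 1/4: the second moment is kept below 5/4, so (W - 1)^2 has mean at most
  1/4, and the elementary inequality behind Le Cam's argument adds another 1/4. The comparison is
  made for each n > 0 separately; limits enter only in the last proof.\<close>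

lemma power_dvd_pderiv:
  fixes r f :: "real poly"
  assumes "r ^ Suc m dvd f"
  shows "r ^ m dvd pderiv f"
proof -
  obtain g where g: "f = r ^ Suc m * g" using assms by blast
  moreover have "r ^ m dvd pderiv (r ^ Suc m)"
    unfolding pderiv_power_Suc by (intro dvd_smult dvd_mult2 dvd_refl)
  moreover have "r ^ m dvd r ^ Suc m" by simp
  ultimately show ?thesis
    unfolding g pderiv_mult by (intro dvd_add dvd_mult dvd_mult2)
qed

lemma power_dvd_pderiv_funpow:
  fixes r f :: "real poly"
  assumes "r ^ M dvd f" "j \<le> M"
  shows "r ^ (M - j) dvd (pderiv ^^ j) f"
  using assms(2)
proof (induction j)
  case (Suc j)
  then have "r ^ Suc (M - Suc j) dvd (pderiv ^^ j) f"
    by (metis Suc_diff_Suc Suc_le_lessD Suc_leD)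
  then show ?case
    using power_dvd_pderiv by (metis funpow.simps(2) comp_apply)
qed (use assms(1) in simp)

text \<open>At an endpoint of the unit interval the bump follows a polynomial on one side and 0 on
  the other. Its difference quotient is dominated by that of the polynomial, so a zero of value and
  derivative survives the truncation.\<close>

lemma has_real_derivative_zero_extension:
  fixes f :: "real \<Rightarrow> real"
  assumes f: "(f has_real_derivative 0) (at x)" and "f x = 0"
    and g: "\<And>y. g y = f y \<or> g y = 0"
  shows "(g has_real_derivative 0) (at x)"
proof -
  have "((\<lambda>y. (f y - f x) / (y - x)) \<longlongrightarrow> 0) (at x)"
    using f by (simp add: has_field_derivative_iff)
  then have "((\<lambda>y. (g y - g x) / (y - x)) \<longlongrightarrow> 0) (at x)"
  proof (rule Lim_null_comparison[rotated, OF tendsto_norm_zero])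
    have "norm ((g y - g x) / (y - x)) \<le> norm ((f y - f x) / (y - x))" for y
      using g[of x] g[of y] \<open>f x = 0\<close> by auto
    then show "\<forall>\<^sub>F y in at x. norm ((g y - g x) / (y - x)) \<le> norm ((f y - f x) / (y - x))"
      by simp
  qed
  then show ?thesis by (simp add: has_field_derivative_iff)
qed

text \<open>\<open>[:0, 1, -1:]\<close> is t(1 - t) and \<open>[:1, -2:]\<close> is 1 - 2t. The
  M-fold zeros at 0 and 1 allow an extension by 0 with M - 1 derivatives; the last factor makes the
  polynomial odd about 1/2, hence of integral zero. Finite smoothness is enough for a Hoelder class,
  and the derivatives stay polynomials.\<close>

definition bump_poly :: "nat \<Rightarrow> real poly" where
  "bump_poly M = [:0, 1, -1:] ^ M * [:1, -2:]"

text \<open>The index \<open>j\<close> is the order of the derivative: truncating the derivatives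
  agrees with differentiating the truncation as long as \<open>j < M\<close>.\<close>

definition bump :: "nat \<Rightarrow> nat \<Rightarrow> real \<Rightarrow> real" where
  "bump M j t = (if t \<in> {0<..<1} then poly ((pderiv ^^ j) (bump_poly M)) t else 0)"

text \<open>Each derivative removes at most one factor t(1 - t), so a positive power of it is left
  while \<open>j < M\<close>.\<close>

lemma poly_funpow_pderiv_bump_poly_eq_0:
  assumes "j < M" "t = 0 \<or> t = 1"
  shows "poly ((pderiv ^^ j) (bump_poly M)) t = 0"
proof -
  have "[:0, 1, -1:] ^ (M - j) dvd (pderiv ^^ j) (bump_poly M)"
    by (rule power_dvd_pderiv_funpow) (use assms in \<open>auto simp: bump_poly_def simp del: mult_pCons_right\<close>)
  then obtain g where "(pderiv ^^ j) (bump_poly M) = [:0, 1, -1:] ^ (M - j) * g" by blast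
  with assms show ?thesis by (auto simp: poly_power)
qed

text \<open>Only the endpoints need an argument: \<open>Suc j < M\<close> makes the polynomial and
  its derivative both vanish there.\<close>

lemma has_real_derivative_bump:
  assumes "Suc j < M"
  shows "(bump M j has_real_derivative bump M (Suc j) t) (at t)"
proof -
  define p where "p = (pderiv ^^ j) (bump_poly M)"
  have p: "(poly p has_real_derivative poly (pderiv p) t) (at t)" by (rule poly_DERIV)
  consider "t \<in> {0<..<1}" | "t = 0 \<or> t = 1" | "t \<in> - {0..1}" by fastforce
  then show ?thesis
  proof cases
    case 1
    then have "(bump M j has_real_derivative poly (pderiv p) t) (at t)"
      using has_field_derivative_transform_within_open[OF p, of "{0<..<1}"]
      by (simp add: bump_def p_def)
    with 1 show ?thesis by (simp add: bump_def p_def)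
  next
    case 2
    then have "poly p t = 0" "poly (pderiv p) t = 0"
      using poly_funpow_pderiv_bump_poly_eq_0[of j M t] poly_funpow_pderiv_bump_poly_eq_0[of "Suc j" M t] assms
      by (auto simp: p_def)
    then have "(bump M j has_real_derivative 0) (at t)"
      using p by (intro has_real_derivative_zero_extension[of "poly p" t "bump M j"])
        (auto simp: bump_def p_def[symmetric])
    with 2 show ?thesis by (auto simp: bump_def)
  next
    case 3
    have "(bump M j has_real_derivative 0) (at t)"
    proof (rule has_field_derivative_transform_within_open[of "\<lambda>_. 0" 0 t "- {0..1}"])
      show "0 = bump M j x" if "x \<in> - {0..1}" for x using that by (auto simp: bump_def)
    qed (use 3 in auto)
    with 3 show ?thesis by (auto simp: bump_def)
  qed
qed

lemma bump_bounded: "\<exists>K\<ge>1. \<forall>j\<le>r. \<forall>t. \<bar>bump M j t\<bar> \<le> K"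
proof -
  have "\<exists>K. \<forall>t. \<bar>bump M j t\<bar> \<le> K" for j
  proof -
    have "compact (poly ((pderiv ^^ j) (bump_poly M)) ` {0..1})"
      by (intro compact_continuous_image continuous_intros) auto
    then obtain K where "\<forall>t\<in>{0..1}. \<bar>poly ((pderiv ^^ j) (bump_poly M)) t\<bar> \<le> K"
      using compact_imp_bounded[of "poly ((pderiv ^^ j) (bump_poly M)) ` {0..1}"]
      by (auto simp: bounded_iff)
    then have "\<bar>bump M j t\<bar> \<le> max K 0" for t
      by (cases "t \<in> {0<..<1}") (auto simp: bump_def intro: le_max_iff_disj[THEN iffD2])
    then show ?thesis by blast
  qed
  then obtain K where K: "\<bar>bump M j t\<bar> \<le> K j" for j t by metis
  have K0: "0 \<le> K j" for j using K[of j 0] by linarith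
  have "\<bar>bump M j t\<bar> \<le> 1 + (\<Sum>i\<le>r. K i)" if "j \<le> r" for j t
    using K[of j t] member_le_sum[of j "{..r}" K] that K0 by force
  then show ?thesis
    by (intro exI[of _ "1 + (\<Sum>i\<le>r. K i)"]) (use K0 in \<open>auto intro: sum_nonneg\<close>)
qed

lemma borel_measurable_bump [measurable]: "bump M j \<in> borel_measurable borel"
proof -
  have [measurable]: "poly ((pderiv ^^ j) (bump_poly M)) \<in> borel_measurable borel"
    by (intro borel_measurable_continuous_onI continuous_intros)
  show ?thesis unfolding bump_def by measurable
qed

lemma bump_0_eq: "bump M 0 t = (if t \<in> {0<..<1} then (t * (1 - t)) ^ M * (1 - 2 * t) else 0)"
  by (simp add: bump_def bump_poly_def poly_power algebra_simps)

text \<open>The reflection of t to 1 - t turns the bump into its negative.\<close>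

lemma integral_bump_eq_0: "(\<integral>t. bump M 0 t \<partial>lborel) = 0"
proof -
  have "(\<integral>t. bump M 0 t \<partial>lborel) = (\<integral>t. bump M 0 (1 + (-1) * t) \<partial>lborel)"
    by (subst lborel_integral_real_affine[of "-1" _ 1]) auto
  also have "\<dots> = (\<integral>t. - bump M 0 t \<partial>lborel)"
    by (intro Bochner_Integration.integral_cong) (auto simp: bump_0_eq algebra_simps)
  finally show ?thesis by simp
qed

lemma abs_bump_0_le: "\<bar>bump M 0 t\<bar> \<le> indicator {0..1} t"
proof (cases "t \<in> {0<..<1}")
  case True
  then have "\<bar>(t * (1 - t)) ^ M * (1 - 2 * t)\<bar> \<le> 1 * 1"
    unfolding abs_mult power_abs by (intro mult_mono power_le_one) (auto intro: mult_le_one)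
  with True show ?thesis by (auto simp: bump_0_eq)
qed (auto simp: bump_0_eq)

lemma integrable_unit_interval_bound:
  fixes f :: "real \<Rightarrow> real"
  assumes "f \<in> borel_measurable borel" "\<And>t. \<bar>f t\<bar> \<le> K * indicator {0..1} t"
  shows "integrable lborel f"
  by (rule Bochner_Integration.integrable_bound[of _ "\<lambda>t. K * indicator {0..1} t"])
    (use assms in \<open>auto intro!: AE_I2 order_trans[OF assms(2)]\<close>)

lemma
  shows integral_bump_square_pos: "0 < (\<integral>t. (bump M 0 t)\<^sup>2 \<partial>lborel)"
    and integral_bump_square_le_1: "(\<integral>t. (bump M 0 t)\<^sup>2 \<partial>lborel) \<le> 1"
proof -
  have le: "(bump M 0 t)\<^sup>2 \<le> indicator {0..1} t" for t
    using power_mono[OF abs_bump_0_le[of M t] abs_ge_zero, of 2]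
    by (auto simp: indicator_def split: if_splits)
  have int: "integrable lborel (\<lambda>t. (bump M 0 t)\<^sup>2)"
    by (rule integrable_unit_interval_bound[where K=1]) (use le in auto)
  have "(\<integral>t. (bump M 0 t)\<^sup>2 \<partial>lborel) \<le> (\<integral>t. indicator {0..1} t \<partial>(lborel :: real measure))"
    by (intro integral_mono int le) auto
  then show "(\<integral>t. (bump M 0 t)\<^sup>2 \<partial>lborel) \<le> 1" by simp
  have "(\<integral>t. (bump M 0 t)\<^sup>2 \<partial>lborel) \<noteq> 0"
  proof
    assume "(\<integral>t. (bump M 0 t)\<^sup>2 \<partial>lborel) = 0"
    then have "AE t in lborel. bump M 0 t = 0"
      by (subst (asm) integral_nonneg_eq_0_iff_AE[OF int]) auto
    \<comment> \<open>The interval stops at 1/2 because the factor 1 - 2t vanishes there.\<close>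
    then have "AE t in lborel. t \<notin> {0<..<1/2::real}"
      by eventually_elim (auto simp: bump_0_eq split: if_splits)
    then have "emeasure lborel {0<..<1/2::real} = 0"
      by (subst (asm) AE_iff_measurable[where N = "{0<..<1/2}"]) auto
    moreover have "emeasure lborel {0<..<1/2::real} = ennreal (1/2)"
      by (subst emeasure_lborel_Ioo) auto
    ultimately show False by simp
  qed
  moreover have "0 \<le> (\<integral>t. (bump M 0 t)\<^sup>2 \<partial>lborel)" by simp
  ultimately show "0 < (\<integral>t. (bump M 0 t)\<^sup>2 \<partial>lborel)" by linarith
qed

section \<open>Hoelder norms of sums of disjoint bumps\<close>

text \<open>The cube is a nondegenerate box, so derivatives within it are unique at boundary points
  too, and the choice made by \<open>frechet_derivative\<close> must be \<open>D\<close>.\<close>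

lemma partial_deriv_eq:
  assumes "(f has_derivative D) (at x within unit_cube)" "x \<in> unit_cube"
  shows "partial_deriv b f x = D b"
proof -
  have "frechet_derivative f (at x within unit_cube) = D"
    using frechet_derivative_unique_within_closed_interval[of 0 One x f] assms
      frechet_derivative_works[of f "at x within unit_cube"]
    by (auto simp: unit_cube_def differentiable_def)
  then show ?thesis by (simp add: partial_deriv_def)
qed

lemma holder_order_le:
  assumes "s > 0"
  shows "real (holder_order s) < s" "s \<le> real (holder_order s) + 1"
proof -
  have "real (holder_order s) = of_int (\<lceil>s\<rceil> - 1)"
    using assms by (simp add: holder_order_def)
  then show "real (holder_order s) < s" "s \<le> real (holder_order s) + 1" by linarith+
qed

text \<open>\<open>Q m\<close> is a class of functions containing the partial derivatives of order \<open>m\<close> of \<open>f\<close>.\<close>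

lemma
  fixes f :: "'a::euclidean_space \<Rightarrow> real" and Q :: "nat \<Rightarrow> ('a \<Rightarrow> real) \<Rightarrow> bool"
  assumes "Q 0 f" "0 < B"
    and diff: "\<And>m h. Q m h \<Longrightarrow> m < holder_order s \<Longrightarrow> h differentiable_on unit_cube"
    and step: "\<And>m h b. Q m h \<Longrightarrow> m < holder_order s \<Longrightarrow> b \<in> Basis \<Longrightarrow> Q (Suc m) (partial_deriv b h)"
    and bound: "\<And>h x. Q (holder_order s) h \<Longrightarrow> x \<in> unit_cube \<Longrightarrow> \<bar>h x\<bar> \<le> B"
    and holder: "\<And>h x x'. Q (holder_order s) h \<Longrightarrow> x \<in> unit_cube \<Longrightarrow> x' \<in> unit_cube \<Longrightarrow>
      \<bar>h x - h x'\<bar> \<le> B * norm (x - x') powr (s - real (holder_order s))"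
  shows holder_spaceI: "f \<in> holder_space s"
    and holder_norm_leI: "holder_norm s f \<le> B"
proof -
  have times: "times_differentiable j h" if "Q m h" "m + j \<le> holder_order s" for m j h
    using that
  proof (induction j arbitrary: m h)
    case (Suc j)
    then have "h differentiable_on unit_cube" by (intro diff) auto
    moreover have "times_differentiable j (partial_deriv b h)" if "b \<in> Basis" for b
      using Suc.prems that by (intro Suc.IH[of "Suc m"] step) auto
    ultimately show ?case by simp
  qed simp
  have pow: "Q (m + j) ((partial_deriv b ^^ j) h)"
    if "Q m h" "m + j \<le> holder_order s" "b \<in> Basis" for m j b h
    using that(2) by (induction j) (use that step in auto)
  \<comment> \<open>\<open>Q\<close> records only the total order of differentiation, so the
    enumeration chosen for the basis is immaterial.\<close>
  have fold_Q: "Q (m + (\<Sum>b\<leftarrow>bs. a b)) (fold (\<lambda>b. partial_deriv b ^^ a b) bs h)"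
    if "Q m h" "m + (\<Sum>b\<leftarrow>bs. a b) \<le> holder_order s" "set bs \<subseteq> Basis" for m bs a h
    using that
  proof (induction bs arbitrary: m h)
    case (Cons b bs)
    then have "Q (m + a b) ((partial_deriv b ^^ a b) h)" by (intro pow) auto
    from Cons.IH[OF this] Cons.prems show ?case by (simp add: add.assoc)
  qed simp
  have "\<exists>bs. distinct bs \<and> set bs = (Basis :: 'a set)"
    using finite_distinct_list[OF finite_Basis] by blast
  then have bs: "distinct (basis_list :: 'a list)" "set (basis_list :: 'a list) = Basis"
    unfolding basis_list_def by (metis (mono_tags, lifting) someI_ex)+
  have "Q (holder_order s) (multi_deriv a f)" if "(\<Sum>b\<in>Basis. a b) = holder_order s" for a
  proof -
    have "(\<Sum>b\<leftarrow>basis_list. a b) = holder_order s"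
      using bs that sum_list_distinct_conv_sum_set[OF bs(1), of a] by simp
    then show ?thesis using fold_Q[where m=0 and h=f and bs=basis_list and a=a] \<open>Q 0 f\<close> bs by (simp add: multi_deriv_def)
  qed
  then have B: "holder_bound s f B"
    using \<open>0 < B\<close> bound holder by (auto simp: holder_bound_def)
  then show "f \<in> holder_space s"
    using times[of 0 f "holder_order s"] \<open>Q 0 f\<close> by (auto simp: holder_space_def)
  show "holder_norm s f \<le> B"
    unfolding holder_norm_def
    by (intro cInf_lower bdd_belowI[of _ 0]) (use B in \<open>auto simp: holder_bound_def\<close>)
qed

lemma
  fixes f :: "'a::euclidean_space \<Rightarrow> real"
  assumes f: "\<And>x. x \<in> unit_cube \<Longrightarrow> f x = a" and a: "\<bar>a\<bar> \<le> B" "0 < B"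
  shows holder_space_const: "f \<in> holder_space s"
    and holder_norm_const: "holder_norm s f \<le> B"
proof -
  \<comment> \<open>One class serves all orders, as the derivative of a constant is the constant 0.
    Only values on the cube are prescribed, because \<open>partial_deriv\<close> is uncontrolled
    outside.\<close>
  define Q where "Q = (\<lambda>(m::nat) (h::'a \<Rightarrow> real). \<exists>a. \<bar>a\<bar> \<le> B \<and> (\<forall>x\<in>unit_cube. h x = a))"
  have der: "(h has_derivative (\<lambda>_. 0)) (at x within unit_cube)"
    if "\<forall>x\<in>unit_cube. h x = a" "x \<in> unit_cube" for h :: "'a \<Rightarrow> real" and a x
    by (rule has_derivative_transform[OF that(2) _ has_derivative_const[of a]]) (use that in auto)
  have Q0: "Q 0 f" using f a unfolding Q_def by blast
  have Q_diff: "h differentiable_on unit_cube" if "Q m h" for m h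
    using that der unfolding Q_def differentiable_on_def differentiable_def by blast
  have Q_step: "Q (Suc m) (partial_deriv b h)" if "Q m h" for m h b
    using that partial_deriv_eq[OF der] a unfolding Q_def by (intro exI[of _ 0]) auto
  show "f \<in> holder_space s"
    by (rule holder_spaceI[where Q=Q and B=B]) (use Q0 Q_diff Q_step a in \<open>auto simp: Q_def\<close>)
  show "holder_norm s f \<le> B"
    by (rule holder_norm_leI[where Q=Q and B=B]) (use Q0 Q_diff Q_step a in \<open>auto simp: Q_def\<close>)
qed

text \<open>Interpolation between a sup bound and a Lipschitz bound: \<open>x\<close> is an
  increment over the distance \<open>t\<close> of a function bounded by \<open>R\<close> with
  Lipschitz constant \<open>d * (R * k)\<close>. The sup bound is the better one for kt \<ge> 1; for
  kt < 1, kt is at most its power with exponent \<beta> \<le> 1.\<close>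

lemma lipschitz_bounded_imp_holder:
  fixes x \<beta> d R k t :: real
  assumes "x \<le> 2 * R" "x \<le> d * (R * k) * t" "1 \<le> d" "0 \<le> R" "0 < k" "0 \<le> t" "0 < \<beta>" "\<beta> \<le> 1"
  shows "x \<le> 2 * d * R * (k * t) powr \<beta>"
proof (cases "1 \<le> k * t")
  case True
  then have "1 \<le> (k * t) powr \<beta>" using assms by (intro ge_one_powr_ge_zero) auto
  then have "2 * R * 1 \<le> 2 * R * (d * (k * t) powr \<beta>)"
    using assms by (intro mult_left_mono) (auto intro: order_trans[OF _ mult_mono[of 1 d 1]])
  with assms show ?thesis by (simp add: mult_ac)
next
  case False
  then have "(k * t) powr 1 \<le> (k * t) powr \<beta>" using assms by (intro powr_mono') auto
  then have "d * R * (k * t) \<le> d * R * (k * t) powr \<beta>"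
    using assms by (intro mult_left_mono) auto
  moreover have "0 \<le> d * R * (k * t) powr \<beta>" using assms by simp
  moreover have "x \<le> d * R * (k * t)" using assms by (simp add: mult_ac)
  moreover have "2 * d * R * (k * t) powr \<beta> = 2 * (d * R * (k * t) powr \<beta>)" by simp
  ultimately show ?thesis by linarith
qed

section \<open>Signed sums of bumps on a grid, with their derivatives\<close>

locale smooth_bump =
  fixes u :: "nat \<Rightarrow> real \<Rightarrow> real" and K :: real and r :: nat
  assumes u_deriv: "\<And>j t. j \<le> r \<Longrightarrow> (u j has_real_derivative u (Suc j) t) (at t)"
    and u_bound: "\<And>j t. j \<le> Suc r \<Longrightarrow> \<bar>u j t\<bar> \<le> K"
    and u_support: "\<And>j t. t \<notin> {0<..<1} \<Longrightarrow> u j t = 0"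
    and K_ge_1: "1 \<le> K"
begin

text \<open>For \<open>a = 0\<close> this is the product bump on the cell of mesh 1/k with lower
  corner J/k. In general it is its partial derivative with multi-index \<open>a\<close>, the powers
  of \<open>k\<close> coming from the chain rule; carrying \<open>a\<close> along makes the family
  closed under differentiation.\<close>

definition cell_bump :: "nat \<Rightarrow> ('a::euclidean_space \<Rightarrow> nat) \<Rightarrow> ('a \<Rightarrow> nat) \<Rightarrow> 'a \<Rightarrow> real" where
  "cell_bump k a J v = (\<Prod>b\<in>Basis. real k ^ a b * u (a b) (real k * (v \<bullet> b) - real (J b)))"

definition cells :: "nat \<Rightarrow> ('a::euclidean_space \<Rightarrow> nat) set" where
  "cells k = Basis \<rightarrow>\<^sub>E {..<k}"

definition bump_sum :: "nat \<Rightarrow> ('a::euclidean_space \<Rightarrow> nat) \<Rightarrow> (('a \<Rightarrow> nat) \<Rightarrow> real) \<Rightarrow> 'a \<Rightarrow> real" where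
  "bump_sum k a \<xi> v = (\<Sum>J\<in>cells k. \<xi> J * cell_bump k a J v)"

lemma finite_cells [simp, intro]: "finite (cells k)"
  by (simp add: cells_def finite_PiE)

lemma has_derivative_cell_bump:
  fixes a J :: "'a::euclidean_space \<Rightarrow> nat"
  assumes "\<And>b. b \<in> Basis \<Longrightarrow> a b \<le> r"
  shows "(cell_bump k a J has_derivative
    (\<lambda>y. \<Sum>b\<in>Basis. (y \<bullet> b) * cell_bump k (a(b := Suc (a b))) J v)) (at v within S)"
proof -
  have *: "((\<lambda>v. real k ^ a b * u (a b) (real k * (v \<bullet> b) - real (J b))) has_derivative
      (\<lambda>y. (y \<bullet> b) * (real k ^ Suc (a b) * u (Suc (a b)) (real k * (v \<bullet> b) - real (J b))))) (at v within S)"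
    if "b \<in> Basis" for b
  proof -
    have "((\<lambda>v. u (a b) (real k * (v \<bullet> b) - real (J b))) has_derivative
        (\<lambda>y. u (Suc (a b)) (real k * (v \<bullet> b) - real (J b)) * (real k * (y \<bullet> b)))) (at v within S)"
      by (rule has_derivative_compose[where g = "u (a b)"])
        (use u_deriv[of "a b"] assms[OF that] in \<open>auto intro!: derivative_eq_intros simp: has_field_derivative_def\<close>)
    from has_derivative_mult_right[OF this, of "real k ^ a b"] show ?thesis
      by (simp add: mult_ac)
  qed
  have "cell_bump k (a(b := Suc (a b))) J v =
      (real k ^ Suc (a b) * u (Suc (a b)) (real k * (v \<bullet> b) - real (J b))) *
      (\<Prod>j\<in>Basis - {b}. real k ^ a j * u (a j) (real k * (v \<bullet> j) - real (J j)))"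
    if "b \<in> Basis" for b
    unfolding cell_bump_def by (subst prod.remove[OF finite_Basis that]) (auto intro!: prod.cong)
  then show ?thesis
    unfolding cell_bump_def [of k a, abs_def]
    by (intro has_derivative_eq_rhs[OF has_derivative_prod[OF *]]) (auto intro!: sum.cong simp: mult_ac)
qed

lemma has_derivative_bump_sum:
  fixes a :: "'a::euclidean_space \<Rightarrow> nat"
  assumes "\<And>b. b \<in> Basis \<Longrightarrow> a b \<le> r"
  shows "(bump_sum k a \<xi> has_derivative
    (\<lambda>y. \<Sum>b\<in>Basis. (y \<bullet> b) * bump_sum k (a(b := Suc (a b))) \<xi> v)) (at v within S)"
proof -
  have "(\<Sum>b\<in>Basis. (y \<bullet> b) * bump_sum k (a(b := Suc (a b))) \<xi> v) =
      (\<Sum>J\<in>cells k. \<xi> J * (\<Sum>b\<in>Basis. (y \<bullet> b) * cell_bump k (a(b := Suc (a b))) J v))" for y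
    unfolding bump_sum_def sum_distrib_left by (subst sum.swap) (simp add: mult_ac)
  then show ?thesis
    unfolding bump_sum_def [of k a, abs_def]
    by (intro has_derivative_eq_rhs[OF has_derivative_sum[OF has_derivative_mult_right]])
      (auto intro!: has_derivative_cell_bump assms)
qed

text \<open>The translates of \<open>u j\<close> by integers have disjoint supports.\<close>

lemma sum_abs_translates_le:
  assumes "j \<le> Suc r"
  shows "(\<Sum>i<k. \<bar>u j (t - real i)\<bar>) \<le> K"
proof (cases "\<exists>i<k. t - real i \<in> {0<..<1}")
  case True
  then obtain i where i: "i < k" "t - real i \<in> {0<..<1}" by blast
  have "u j (t - real i') = 0" if "i' \<noteq> i" for i'
    using i that by (intro u_support) (cases i' i rule: linorder_cases; auto)
  then have "(\<Sum>i'<k. \<bar>u j (t - real i')\<bar>) = (\<Sum>i'\<in>{i}. \<bar>u j (t - real i')\<bar>)"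
    using i by (intro sum.mono_neutral_right) auto
  then show ?thesis using u_bound[OF assms] by simp
next
  case False
  then have "(\<Sum>i<k. \<bar>u j (t - real i)\<bar>) = 0" by (intro sum.neutral) (auto simp: u_support)
  then show ?thesis using K_ge_1 by simp
qed

text \<open>The sum over all cells factorises over the coordinates, and in each coordinate at most
  one translate is nonzero. Hence the number of cells does not enter the bound.\<close>

lemma sum_abs_cell_bump_le:
  fixes a :: "'a::euclidean_space \<Rightarrow> nat"
  assumes "\<And>b. b \<in> Basis \<Longrightarrow> a b \<le> Suc r"
  shows "(\<Sum>J\<in>cells k. \<bar>cell_bump k a J v\<bar>) \<le> K ^ DIM('a) * real k ^ (\<Sum>b\<in>Basis. a b)"
proof -
  have "(\<Sum>J\<in>cells k. \<bar>cell_bump k a J v\<bar>) =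
      (\<Prod>b\<in>Basis. \<Sum>i<k. real k ^ a b * \<bar>u (a b) (real k * (v \<bullet> b) - real i)\<bar>)"
    unfolding cells_def cell_bump_def by (subst prod_sum_PiE) (auto simp: abs_prod abs_mult)
  also have "\<dots> \<le> (\<Prod>b\<in>(Basis :: 'a set). real k ^ a b * K)"
    unfolding sum_distrib_left[symmetric]
    by (intro prod_mono conjI mult_left_mono sum_abs_translates_le assms) (auto intro!: sum_nonneg mult_nonneg_nonneg)
  also have "\<dots> = K ^ DIM('a) * real k ^ (\<Sum>b\<in>Basis. a b)"
    by (simp add: prod.distrib power_sum mult.commute)
  finally show ?thesis .
qed

lemma abs_bump_sum_le:
  fixes a :: "'a::euclidean_space \<Rightarrow> nat"
  assumes "\<And>b. b \<in> Basis \<Longrightarrow> a b \<le> Suc r" and \<xi>: "\<And>J. J \<in> cells k \<Longrightarrow> \<bar>\<xi> J\<bar> \<le> \<rho>" "0 \<le> \<rho>"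
  shows "\<bar>bump_sum k a \<xi> v\<bar> \<le> \<rho> * K ^ DIM('a) * real k ^ (\<Sum>b\<in>Basis. a b)"
proof -
  have "\<bar>bump_sum k a \<xi> v\<bar> \<le> (\<Sum>J\<in>cells k. \<rho> * \<bar>cell_bump k a J v\<bar>)"
    unfolding bump_sum_def
    by (intro order_trans[OF sum_abs] sum_mono) (auto simp: abs_mult intro!: mult_right_mono \<xi>)
  also have "\<dots> \<le> \<rho> * (K ^ DIM('a) * real k ^ (\<Sum>b\<in>Basis. a b))"
    unfolding sum_distrib_left[symmetric]
    by (intro mult_left_mono sum_abs_cell_bump_le assms)
  finally show ?thesis by (simp add: mult_ac)
qed

text \<open>Mean value inequality: each of the \<open>DIM('a)\<close> partial derivatives is a bump
  sum of one order more, whence the extra factor \<open>k\<close>. This is why the bounds on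
  \<open>u\<close> reach order \<open>Suc r\<close>.\<close>

lemma bump_sum_lipschitz:
  fixes a :: "'a::euclidean_space \<Rightarrow> nat"
  assumes a: "\<And>b. b \<in> Basis \<Longrightarrow> a b \<le> r" and \<xi>: "\<And>J. J \<in> cells k \<Longrightarrow> \<bar>\<xi> J\<bar> \<le> \<rho>" "0 \<le> \<rho>"
  shows "\<bar>bump_sum k a \<xi> v - bump_sum k a \<xi> w\<bar>
    \<le> real DIM('a) * (\<rho> * K ^ DIM('a) * real k ^ Suc (\<Sum>b\<in>Basis. a b)) * norm (v - w)"
proof -
  define R where "R = \<rho> * K ^ DIM('a) * real k ^ Suc (\<Sum>b\<in>Basis. a b)"
  have "norm (bump_sum k a \<xi> v - bump_sum k a \<xi> w) \<le> (real DIM('a) * R) * norm (v - w)"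
  proof (rule differentiable_bound[OF convex_UNIV has_derivative_bump_sum[OF a]])
    fix x :: 'a
    show "onorm (\<lambda>y. \<Sum>b\<in>Basis. (y \<bullet> b) * bump_sum k (a(b := Suc (a b))) \<xi> x) \<le> real DIM('a) * R"
    proof (rule onorm_le)
      fix y :: 'a
      have R: "\<bar>bump_sum k (a(b := Suc (a b))) \<xi> x\<bar> \<le> R" if "b \<in> Basis" for b
      proof -
        have "(\<Sum>c\<in>Basis. (a(b := Suc (a b))) c) = Suc (\<Sum>b\<in>Basis. a b)"
          by (subst (1 2) sum.remove[OF finite_Basis that]) (auto intro!: sum.cong)
        moreover have "(a(b := Suc (a b))) c \<le> Suc r" if "c \<in> Basis" for c
          using a[OF that] by auto
        ultimately show ?thesis
          using abs_bump_sum_le[of "a(b := Suc (a b))" k \<xi> \<rho> x] \<xi> unfolding R_def by metis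
      qed
      have "norm (\<Sum>b\<in>Basis. (y \<bullet> b) * bump_sum k (a(b := Suc (a b))) \<xi> x)
          \<le> (\<Sum>b\<in>(Basis::'a set). norm y * R)"
        by (intro order_trans[OF norm_sum] sum_mono)
          (auto simp: abs_mult intro!: mult_mono R Basis_le_norm)
      then show "norm (\<Sum>b\<in>Basis. (y \<bullet> b) * bump_sum k (a(b := Suc (a b))) \<xi> x) \<le> real DIM('a) * R * norm y"
        by (simp add: mult_ac)
    qed
  qed auto
  then show ?thesis by (simp add: R_def)
qed

text \<open>With s0 the Hoelder order and \<beta> = s - s0, derivatives of order s0 are bounded by R
  = \<rho> K^d k^s0 and have Lipschitz constant d R k. Interpolation gives the Hoelder constant 2 d
  R k^\<beta> = 2 d K^d \<rho> k^s, so a height \<rho> of order k^(-s) keeps the norm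
  bounded.\<close>

lemma
  fixes \<xi> :: "('a::euclidean_space \<Rightarrow> nat) \<Rightarrow> real"
  assumes s: "0 < s" "r = holder_order s" and k: "1 \<le> k"
    and \<xi>: "\<And>J. J \<in> cells k \<Longrightarrow> \<bar>\<xi> J\<bar> \<le> \<rho>" and "0 < \<rho>"
    and B: "2 * real DIM('a) * K ^ DIM('a) * \<rho> * real k powr s \<le> B"
  shows bump_sum_in_holder_space: "bump_sum k (\<lambda>_. 0) \<xi> \<in> holder_space s"
    and holder_norm_bump_sum_le: "holder_norm s (bump_sum k (\<lambda>_. 0) \<xi>) \<le> B"
proof -
  define \<beta> where "\<beta> = s - real (holder_order s)"
  have \<beta>: "0 < \<beta>" "\<beta> \<le> 1" using holder_order_le[OF s(1)] by (auto simp: \<beta>_def)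
  define R where "R = \<rho> * K ^ DIM('a) * real k ^ holder_order s"
  have "0 < R" using \<open>0 < \<rho>\<close> K_ge_1 k by (auto simp: R_def)
  have "1 \<le> DIM('a)" using DIM_positive[where 'a='a] by linarith
  have "real k ^ holder_order s * real k powr \<beta> = real k powr s"
    using k by (simp add: \<beta>_def powr_diff powr_realpow)
  with B have B': "2 * real DIM('a) * R * real k powr \<beta> \<le> B"
    by (simp add: R_def mult_ac)
  moreover have "1 * 1 \<le> real k powr \<beta> * real DIM('a)"
    using k \<beta> \<open>1 \<le> DIM('a)\<close> by (intro mult_mono ge_one_powr_ge_zero) auto
  then have "2 * R * 1 \<le> 2 * R * (real k powr \<beta> * real DIM('a))"
    using \<open>0 < R\<close> by (intro mult_left_mono) auto
  moreover have "2 * R * (real k powr \<beta> * real DIM('a)) = 2 * real DIM('a) * R * real k powr \<beta>"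
    by simp
  ultimately have RB: "R \<le> B" using \<open>0 < R\<close> by linarith
  then have "0 < B" using \<open>0 < R\<close> by linarith
  \<comment> \<open>Agreement is required on the cube only, since each \<open>partial_deriv\<close>
    is known only there.\<close>
  define Q where "Q = (\<lambda>m h. \<exists>a :: 'a \<Rightarrow> nat. (\<Sum>b\<in>Basis. a b) = m \<and> (\<forall>x\<in>unit_cube. h x = bump_sum k a \<xi> x))"
  have le: "a b \<le> m" if "(\<Sum>b\<in>Basis. a b) = m" "b \<in> Basis" for a :: "'a \<Rightarrow> nat" and m b
    using member_le_sum[of b Basis a] that by auto
  have der: "(h has_derivative (\<lambda>y. \<Sum>b\<in>Basis. (y \<bullet> b) * bump_sum k (a(b := Suc (a b))) \<xi> x)) (at x within unit_cube)"
    if "(\<Sum>b\<in>Basis. a b) = m" "\<forall>x\<in>unit_cube. h x = bump_sum k a \<xi> x" "m < holder_order s" "x \<in> unit_cube"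
    for h :: "'a \<Rightarrow> real" and a m x
    by (rule has_derivative_transform[OF that(4) _ has_derivative_bump_sum[of a]])
      (use that le[OF that(1)] s in force)+
  have Q0: "Q 0 (bump_sum k (\<lambda>_. 0) \<xi>)" by (auto simp: Q_def intro!: exI[of _ "\<lambda>_. 0"])
  have Q_diff: "h differentiable_on unit_cube" if "Q m h" "m < holder_order s" for m h
    using that der unfolding Q_def differentiable_on_def differentiable_def by blast
  have Q_step: "Q (Suc m) (partial_deriv b h)" if "Q m h" "m < holder_order s" and b: "b \<in> Basis" for m h b
  proof -
    from that obtain a where a: "(\<Sum>b\<in>Basis. a b) = m" "\<forall>x\<in>unit_cube. h x = bump_sum k a \<xi> x"
      by (auto simp: Q_def)
    have "(\<Sum>c\<in>Basis. (a(b := Suc (a b))) c) = Suc (\<Sum>b\<in>Basis. a b)"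
      by (subst (1 2) sum.remove[OF finite_Basis b]) (auto intro!: sum.cong)
    moreover have "partial_deriv b h x = bump_sum k (a(b := Suc (a b))) \<xi> x" if "x \<in> unit_cube" for x
    proof -
      have "partial_deriv b h x = (\<Sum>c\<in>Basis. (b \<bullet> c) * bump_sum k (a(c := Suc (a c))) \<xi> x)"
        using partial_deriv_eq[OF der[OF a] that] \<open>m < holder_order s\<close> that by simp
      also have "\<dots> = (\<Sum>c\<in>Basis. if c = b then bump_sum k (a(c := Suc (a c))) \<xi> x else 0)"
        using b by (intro sum.cong) (auto simp: inner_Basis)
      finally show ?thesis using b by simp
    qed
    ultimately show ?thesis using a unfolding Q_def by metis
  qed
  have Q_bound: "\<bar>h x\<bar> \<le> R" if "Q (holder_order s) h" "x \<in> unit_cube" for h x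
  proof -
    from that obtain a where a: "(\<Sum>b\<in>Basis. a b) = holder_order s" "\<forall>x\<in>unit_cube. h x = bump_sum k a \<xi> x"
      by (auto simp: Q_def)
    then show ?thesis
      using abs_bump_sum_le[of a k \<xi> \<rho> x] le[OF a(1)] \<xi> \<open>0 < \<rho>\<close> that(2) s by (auto simp: R_def le_SucI)
  qed
  have Q_holder: "\<bar>h x - h x'\<bar> \<le> B * norm (x - x') powr (s - real (holder_order s))"
    if "Q (holder_order s) h" and x: "x \<in> unit_cube" "x' \<in> unit_cube" for h x x'
  proof -
    from that obtain a where a: "(\<Sum>b\<in>Basis. a b) = holder_order s" "\<forall>x\<in>unit_cube. h x = bump_sum k a \<xi> x"
      by (auto simp: Q_def)
    have "\<bar>h x - h x'\<bar> \<le> real DIM('a) * (R * real k) * norm (x - x')"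
      using bump_sum_lipschitz[of a k \<xi> \<rho> x x'] le[OF a(1)] \<xi> \<open>0 < \<rho>\<close> x s a
      by (auto simp: R_def mult_ac)
    moreover have "\<bar>h x - h x'\<bar> \<le> 2 * R"
      using Q_bound[OF that(1)] x by (smt (verit))
    ultimately have "\<bar>h x - h x'\<bar> \<le> 2 * real DIM('a) * R * (real k * norm (x - x')) powr \<beta>"
      using \<open>1 \<le> DIM('a)\<close> \<open>0 < R\<close> k \<beta> by (intro lipschitz_bounded_imp_holder) auto
    also have "\<dots> = (2 * real DIM('a) * R * real k powr \<beta>) * norm (x - x') powr \<beta>"
      by (simp add: powr_mult)
    also have "\<dots> \<le> B * norm (x - x') powr \<beta>"
      by (intro mult_right_mono B') auto
    finally show ?thesis by (simp add: \<beta>_def)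
  qed
  have Q_bound': "\<bar>h x\<bar> \<le> B" if "Q (holder_order s) h" "x \<in> unit_cube" for h x
    using Q_bound[OF that] RB by linarith
  show "bump_sum k (\<lambda>_. 0) \<xi> \<in> holder_space s"
    by (rule holder_spaceI[where Q=Q and B=B]) (use Q0 \<open>0 < B\<close> Q_diff Q_step Q_bound' Q_holder in blast)+
  show "holder_norm s (bump_sum k (\<lambda>_. 0) \<xi>) \<le> B"
    by (rule holder_norm_leI[where Q=Q and B=B]) (use Q0 \<open>0 < B\<close> Q_diff Q_step Q_bound' Q_holder in blast)+
qed

end

section \<open>Laws with a sign-valued response\<close>

definition uniform_cube :: "'a::euclidean_space measure" where
  "uniform_cube = density lborel (indicator unit_cube)"

lemma sets_uniform_cube [simp, measurable_cong]: "sets uniform_cube = sets borel"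
  by (simp add: uniform_cube_def)

lemma space_uniform_cube [simp]: "space uniform_cube = UNIV"
  by (simp add: uniform_cube_def)

lemma unit_cube_borel [measurable]: "unit_cube \<in> sets borel"
  by (simp add: unit_cube_def)

lemma emeasure_lborel_unit_cube: "emeasure lborel (unit_cube :: 'a::euclidean_space set) = 1"
  by (simp add: unit_cube_def)

lemma prob_space_uniform_cube: "prob_space (uniform_cube :: 'a::euclidean_space measure)"
  by (rule prob_spaceI) (simp add: uniform_cube_def emeasure_density emeasure_lborel_unit_cube)

lemma AE_uniform_cube: "AE v in uniform_cube. v \<in> unit_cube"
  unfolding uniform_cube_def by (subst AE_density) (auto split: split_indicator_asm)

lemma integral_uniform_cube:
  fixes f :: "'a::euclidean_space \<Rightarrow> real"
  assumes [measurable]: "f \<in> borel_measurable borel"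
  shows "(\<integral>v. f v \<partial>uniform_cube) = (\<integral>v. indicator unit_cube v * f v \<partial>lborel)"
proof -
  have eq: "(uniform_cube :: 'a measure) = density lborel (\<lambda>v. ennreal (indicator unit_cube v :: real))"
    by (simp add: uniform_cube_def ennreal_indicator)
  show ?thesis unfolding eq by (subst integral_real_density) auto
qed

definition assemble :: "((real^'dx) \<times> (real^'dz)) \<times> real \<Rightarrow> ('dx::finite, 'dz::finite) obs" where
  "assemble w = (fst (fst w), snd w, snd (fst w))"

definition null_law :: "('dx::finite, 'dz::finite) obs measure" where
  "null_law = distr (uniform_cube \<Otimes>\<^sub>M measure_pmf (pmf_of_set {-1, 1})) borel assemble"

text \<open>As \<open>Y\<close> is a sign almost surely, \<open>sgn\<close> only serves to make the density nonnegative everywhere.\<close>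

definition law :: "((real^'dx) \<times> (real^'dz) \<Rightarrow> real) \<Rightarrow> ('dx::finite, 'dz::finite) obs measure" where
  "law h = density null_law (\<lambda>w. ennreal (1 + sgn (obs_Y w) * h (obs_XZ w)))"

lemma sets_null_law [simp, measurable_cong]: "sets null_law = sets borel"
  by (simp add: null_law_def)

lemma sets_law [simp, measurable_cong]: "sets (law h) = sets borel"
  by (simp add: law_def)

lemma space_null_law [simp]: "space null_law = UNIV"
  by (simp add: null_law_def)

lemma space_law [simp]: "space (law h) = UNIV"
  by (simp add: law_def)

lemma law_0: "law (\<lambda>_. 0) = null_law"
  by (simp add: law_def density_1)

lemma measurable_assemble [measurable]:
  "assemble \<in> uniform_cube \<Otimes>\<^sub>M measure_pmf (pmf_of_set {-1, 1}) \<rightarrow>\<^sub>M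
    (borel :: ('dx::finite, 'dz::finite) obs measure)"
proof -
  have fst: "fst \<in> uniform_cube \<rightarrow>\<^sub>M (borel :: (real^'dx) measure)"
    and snd: "snd \<in> uniform_cube \<rightarrow>\<^sub>M (borel :: (real^'dz) measure)"
    by (simp_all add: measurable_cong_sets[OF sets_uniform_cube refl] borel_measurable_continuous_onI
        continuous_on_fst continuous_on_snd)
  have id: "(\<lambda>x. x) \<in> measure_pmf (pmf_of_set {-1, 1}) \<rightarrow>\<^sub>M (borel :: real measure)" by simp
  show ?thesis
    unfolding assemble_def [abs_def]
    by (intro borel_measurable_Pair measurable_compose[OF measurable_fst fst]
        measurable_compose[OF measurable_fst snd] measurable_compose[OF measurable_snd id])
qed

lemma measurable_obs [measurable]:
  "obs_Y \<in> borel_measurable borel" "obs_Z \<in> borel_measurable borel" "obs_XZ \<in> borel_measurable borel"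
  unfolding obs_Y_def [abs_def] obs_Z_def [abs_def] obs_XZ_def [abs_def]
  by (auto intro!: borel_measurable_continuous_onI continuous_intros)

lemma obs_assemble [simp]:
  "obs_Y (assemble w) = snd w" "obs_Z (assemble w) = snd (fst w)" "obs_XZ (assemble w) = fst w"
  by (simp_all add: assemble_def obs_Y_def obs_Z_def obs_XZ_def)

lemma prob_space_null_law: "prob_space null_law"
proof -
  interpret U: prob_space uniform_cube by (rule prob_space_uniform_cube)
  interpret pair_prob_space uniform_cube "measure_pmf (pmf_of_set {-1, 1::real})"
    by unfold_locales
  show ?thesis unfolding null_law_def by (rule prob_space_distr) measurable
qed

lemma AE_null_law:
  "AE w in (null_law :: ('dx::finite, 'dz::finite) obs measure). obs_XZ w \<in> unit_cube \<and> obs_Y w \<in> {-1, 1}"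
proof -
  let ?U = "uniform_cube :: ((real^'dx) \<times> (real^'dz)) measure"
  interpret U: prob_space ?U by (rule prob_space_uniform_cube)
  interpret pair_prob_space ?U "measure_pmf (pmf_of_set {-1, 1::real})"
    by unfold_locales
  define S where "S = {-1, 1::real}"
  have [measurable]: "S \<in> sets (measure_pmf (pmf_of_set {-1, 1}))" by simp
  have "AE w in ?U \<Otimes>\<^sub>M measure_pmf (pmf_of_set {-1, 1}). fst w \<in> unit_cube \<and> snd w \<in> S"
  proof (rule AE_pair_measure)
    show "AE v in ?U. AE y in measure_pmf (pmf_of_set {-1, 1}). fst (v, y) \<in> unit_cube \<and> snd (v, y) \<in> S"
      using AE_uniform_cube by eventually_elim (simp add: AE_measure_pmf_iff S_def)
  qed measurable
  then show ?thesis
    unfolding null_law_def S_def by (subst AE_distr_iff) auto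
qed

text \<open>A fair sign turns the integral into the average over the two sheets y = 1 and y = -1.
  The bound is demanded only where the law lives: \<open>obs_Y\<close>, for instance, is unbounded
  on the ambient space.\<close>

lemma
  fixes f :: "('dx::finite, 'dz::finite) obs \<Rightarrow> real"
  assumes [measurable]: "f \<in> borel_measurable borel"
    and B: "\<And>w. obs_XZ w \<in> unit_cube \<Longrightarrow> obs_Y w \<in> {-1, 1} \<Longrightarrow> \<bar>f w\<bar> \<le> B"
  shows integrable_null_law: "integrable null_law f"
    and integral_null_law: "(\<integral>w. f w \<partial>null_law) =
      (\<integral>v. (f (assemble (v, 1)) + f (assemble (v, -1))) / 2 \<partial>uniform_cube)"
proof -
  interpret N: prob_space "null_law :: ('dx, 'dz) obs measure" by (rule prob_space_null_law)
  interpret U: prob_space "uniform_cube :: ((real^'dx) \<times> (real^'dz)) measure" by (rule prob_space_uniform_cube)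
  interpret pair_prob_space "uniform_cube :: ((real^'dx) \<times> (real^'dz)) measure" "measure_pmf (pmf_of_set {-1, 1::real})"
    by unfold_locales
  show int: "integrable null_law f"
  proof (rule N.integrable_const_bound)
    show "AE w in null_law. norm (f w) \<le> B"
      using AE_null_law by eventually_elim (use B in auto)
  qed measurable
  then have "integrable (uniform_cube \<Otimes>\<^sub>M measure_pmf (pmf_of_set {-1, 1})) (\<lambda>w. f (assemble w))"
    unfolding null_law_def by (subst (asm) integrable_distr_eq) auto
  from integral_fst'[OF this] 
  have "(\<integral>w. f w \<partial>null_law) = (\<integral>v. (\<integral>y. f (assemble (v, y)) \<partial>measure_pmf (pmf_of_set {-1, 1})) \<partial>uniform_cube)"
    unfolding null_law_def by (subst integral_distr) auto
  also have "\<dots> = (\<integral>v. (f (assemble (v, 1)) + f (assemble (v, -1))) / 2 \<partial>uniform_cube)"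
    by (simp add: integral_pmf_of_set add.commute)
  finally show "(\<integral>w. f w \<partial>null_law) = (\<integral>v. (f (assemble (v, 1)) + f (assemble (v, -1))) / 2 \<partial>uniform_cube)" .
qed

section \<open>Tilted laws: marginals and conditional means\<close>

locale regression_function =
  fixes h :: "(real^'dx::finite) \<times> (real^'dz::finite) \<Rightarrow> real"
  assumes h_measurable [measurable]: "h \<in> borel_measurable borel"
    and h_bound: "\<And>v. \<bar>h v\<bar> \<le> 1"
begin

lemma density_bounds:
  "\<bar>1 + sgn y * h v\<bar> \<le> 2" "0 \<le> 1 + sgn y * h v"
  using h_bound[of v] by (auto simp: abs_le_iff sgn_real_def)

lemma AE_law: "AE w in law h. obs_XZ w \<in> unit_cube \<and> obs_Y w \<in> {-1, 1}"
proof -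
  have "AE w in null_law. 0 < ennreal (1 + sgn (obs_Y w) * h (obs_XZ w)) \<longrightarrow>
      obs_XZ w \<in> unit_cube \<and> obs_Y w \<in> {-1, 1}"
    using AE_null_law by eventually_elim simp
  then show ?thesis unfolding law_def by (subst AE_density) auto
qed

lemma
  fixes f :: "('dx, 'dz) obs \<Rightarrow> real"
  assumes f [measurable]: "f \<in> borel_measurable borel"
    and B: "\<And>w. obs_XZ w \<in> unit_cube \<Longrightarrow> obs_Y w \<in> {-1, 1} \<Longrightarrow> \<bar>f w\<bar> \<le> B"
  shows integrable_law: "integrable (law h) f"
    and integral_law: "(\<integral>w. f w \<partial>law h) =
      (\<integral>v. ((1 + h v) * f (assemble (v, 1)) + (1 - h v) * f (assemble (v, -1))) / 2 \<partial>uniform_cube)"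
proof -
  have B': "\<bar>(1 + sgn (obs_Y w) * h (obs_XZ w)) * f w\<bar> \<le> 2 * B" if "obs_XZ w \<in> unit_cube" "obs_Y w \<in> {-1, 1}" for w
    unfolding abs_mult by (intro mult_mono density_bounds B that) auto
  have "integrable null_law (\<lambda>w. (1 + sgn (obs_Y w) * h (obs_XZ w)) * f w)"
    by (rule integrable_null_law[OF _ B']) auto
  then show "integrable (law h) f"
    unfolding law_def using density_bounds by (subst integrable_real_density) auto
  have eq: "(\<integral>w. f w \<partial>law h) = (\<integral>w. (1 + sgn (obs_Y w) * h (obs_XZ w)) * f w \<partial>null_law)"
    unfolding law_def using density_bounds by (subst integral_real_density) auto
  show "(\<integral>w. f w \<partial>law h) =
      (\<integral>v. ((1 + h v) * f (assemble (v, 1)) + (1 - h v) * f (assemble (v, -1))) / 2 \<partial>uniform_cube)"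
    unfolding eq by (subst integral_null_law[OF _ B']) auto
qed

text \<open>The weights 1 + h and 1 - h of the two signs add up to 2, so the tilt leaves (X, Z)
  uniform.\<close>

lemma integral_law_XZ:
  fixes f :: "(real^'dx) \<times> (real^'dz) \<Rightarrow> real"
  assumes f [measurable]: "f \<in> borel_measurable borel" and B: "\<And>v. v \<in> unit_cube \<Longrightarrow> \<bar>f v\<bar> \<le> B"
  shows "(\<integral>w. f (obs_XZ w) \<partial>law h) = (\<integral>v. f v \<partial>uniform_cube)"
  by (subst integral_law[OF _ B]) (simp_all add: algebra_simps)

text \<open>Here the weights enter with opposite signs and differ by 2h, which is what makes
  \<open>h\<close> the regression of Y on (X, Z).\<close>

lemma integral_law_Y:
  fixes f :: "(real^'dx) \<times> (real^'dz) \<Rightarrow> real"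
  assumes f [measurable]: "f \<in> borel_measurable borel" and B: "\<And>v. v \<in> unit_cube \<Longrightarrow> \<bar>f v\<bar> \<le> B"
  shows "(\<integral>w. f (obs_XZ w) * obs_Y w \<partial>law h) = (\<integral>v. f v * h v \<partial>uniform_cube)"
proof -
  have "\<bar>f (obs_XZ w) * obs_Y w\<bar> \<le> B" if "obs_XZ w \<in> unit_cube" "obs_Y w \<in> {-1, 1}" for w
    using that B[of "obs_XZ w"] by (auto simp: abs_mult)
  then show ?thesis by (subst integral_law) (simp_all add: algebra_simps)
qed

lemma prob_space_law: "prob_space (law h)"
proof (rule prob_spaceI)
  interpret N: prob_space "null_law :: ('dx, 'dz) obs measure" by (rule prob_space_null_law)
  interpret U: prob_space "uniform_cube :: ((real^'dx) \<times> (real^'dz)) measure" by (rule prob_space_uniform_cube)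
  have int: "integrable null_law (\<lambda>w. 1 + sgn (obs_Y w) * h (obs_XZ w))"
    by (rule integrable_null_law[where B=2]) (use density_bounds in auto)
  have "emeasure (law h) (space (law h)) = ennreal (\<integral>w. 1 + sgn (obs_Y w) * h (obs_XZ w) \<partial>null_law)"
    unfolding law_def by (subst emeasure_density)
     (use nn_integral_eq_integral[OF int] density_bounds in auto)
  also have "(\<integral>w. 1 + sgn (obs_Y w) * h (obs_XZ w) \<partial>null_law) = 1"
    by (subst integral_null_law[where B=2]) (use density_bounds U.prob_space in auto)
  finally show "emeasure (law h) (space (law h)) = 1" by simp
qed

lemma distr_law_XZ: "distr (law h) lborel obs_XZ = uniform_cube"
proof (rule measure_eqI)
  interpret L: prob_space "law h" by (rule prob_space_law)
  interpret U: prob_space "uniform_cube :: ((real^'dx) \<times> (real^'dz)) measure" by (rule prob_space_uniform_cube)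
  fix A assume "A \<in> sets (distr (law h) lborel obs_XZ)"
  then have [measurable]: "A \<in> sets borel" by simp
  have "emeasure (distr (law h) lborel obs_XZ) A = emeasure (law h) (obs_XZ -` A)"
    by (subst emeasure_distr) (auto simp: measurable_lborel1)
  also have "\<dots> = ennreal (\<integral>w. indicator A (obs_XZ w) \<partial>law h)"
  proof -
    have "indicator A (obs_XZ w) = (indicator (obs_XZ -` A) w :: real)" for w by (simp add: indicator_def)
    then show ?thesis
      using measurable_sets[OF measurable_obs(3) \<open>A \<in> sets borel\<close>] by (simp add: L.emeasure_eq_measure)
  qed
  also have "\<dots> = ennreal (\<integral>v. indicator A v \<partial>uniform_cube)"
    by (subst integral_law_XZ[where B=1]) (auto simp: indicator_def)
  finally show "emeasure (distr (law h) lborel obs_XZ) A = emeasure uniform_cube A"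
    by (simp add: U.emeasure_eq_measure)
qed simp

lemma subalgebra_gen_sigma:
  fixes W :: "('dx, 'dz) obs \<Rightarrow> 'b::topological_space"
  assumes "W \<in> borel_measurable borel"
  shows "finite_measure_subalgebra (law h) (gen_sigma (law h) W)"
proof -
  interpret L: prob_space "law h" by (rule prob_space_law)
  show ?thesis
    by unfold_locales
      (use measurable_sets[OF assms] in \<open>auto simp: subalgebra_def gen_sigma_def sets_vimage_algebra2\<close>)
qed

text \<open>The events of \<open>gen_sigma\<close> are preimages under \<open>W\<close>, so testing
  against indicators of Borel sets evaluated at \<open>W\<close> is enough.\<close>

lemma cond_mean_versionI:
  fixes W :: "('dx, 'dz) obs \<Rightarrow> 'b::topological_space"
  assumes W [measurable]: "W \<in> borel_measurable borel" and f [measurable]: "f \<in> borel_measurable borel"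
    and f_le: "\<And>x. \<bar>f x\<bar> \<le> 1"
    and eq: "\<And>B. B \<in> sets borel \<Longrightarrow>
      (\<integral>w. indicator B (W w) * obs_Y w \<partial>law h) = (\<integral>w. indicator B (W w) * f (W w) \<partial>law h)"
  shows "cond_mean_version (law h) W f"
  unfolding cond_mean_version_def
proof (intro conjI f)
  interpret finite_measure_subalgebra "law h" "gen_sigma (law h) W" by (rule subalgebra_gen_sigma[OF W])
  have W': "W \<in> gen_sigma (law h) W \<rightarrow>\<^sub>M borel"
    unfolding gen_sigma_def by (rule measurable_vimage_algebra1) simp
  show "AE w in law h. real_cond_exp (law h) (gen_sigma (law h) W) obs_Y w = f (W w)"
  proof (rule real_cond_exp_charact)
    fix A assume "A \<in> sets (gen_sigma (law h) W)"
    then obtain B where B: "B \<in> sets borel" "A = W -` B"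
      by (auto simp: gen_sigma_def sets_vimage_algebra2)
    then have "indicator A w = (indicator B (W w) :: real)" for w by (simp add: indicator_def)
    then show "(\<integral>w\<in>A. obs_Y w \<partial>law h) = (\<integral>w\<in>A. f (W w) \<partial>law h)"
      using eq[OF B(1)] by (simp add: set_lebesgue_integral_def)
  next
    show "integrable (law h) obs_Y" by (rule integrable_law[where B=1]) auto
    show "integrable (law h) (\<lambda>w. f (W w))" by (rule integrable_law[where B=1]) (use f_le in auto)
    show "(\<lambda>w. f (W w)) \<in> borel_measurable (gen_sigma (law h) W)"
      using measurable_compose[OF W' f] .
  qed
qed

end

text \<open>The added assumption is the integrated form of E(h(X, Z) | Z) = 0, which is how the
  characterisation of conditional expectations uses it. It yields the version m = 0.\<close>

locale centred_regression_function = regression_function h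
  for h :: "(real^'dx::finite) \<times> (real^'dz::finite) \<Rightarrow> real" +
  assumes h_centred: "\<And>B. B \<in> sets borel \<Longrightarrow> (\<integral>v. indicator B (snd v) * h v \<partial>uniform_cube) = 0"
begin

lemma cond_mean_version_XZ: "cond_mean_version (law h) obs_XZ h"
proof (rule cond_mean_versionI)
  fix B :: "((real^'dx) \<times> (real^'dz)) set" assume [measurable]: "B \<in> sets borel"
  show "(\<integral>w. indicator B (obs_XZ w) * obs_Y w \<partial>law h) = (\<integral>w. indicator B (obs_XZ w) * h (obs_XZ w) \<partial>law h)"
    by (subst integral_law_Y[where B=1], simp, simp add: indicator_def,
        subst integral_law_XZ[where f="\<lambda>v. indicator B v * h v" and B=1])
      (use h_bound in \<open>auto simp: indicator_def\<close>)
qed (use h_bound in auto)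

lemma cond_mean_version_Z: "cond_mean_version (law h) obs_Z (\<lambda>_. 0)"
proof (rule cond_mean_versionI)
  fix B :: "(real^'dz) set" assume [measurable]: "B \<in> sets borel"
  have [measurable]: "(snd :: (real^'dx) \<times> (real^'dz) \<Rightarrow> _) \<in> borel_measurable borel"
    by (intro borel_measurable_continuous_onI continuous_intros)
  have "(\<integral>w. indicator B (snd (obs_XZ w)) * obs_Y w \<partial>law h) = (\<integral>v. indicator B (snd v) * h v \<partial>uniform_cube)"
    by (rule integral_law_Y[where B=1]) (auto simp: indicator_def)
  also have "\<dots> = 0" by (rule h_centred) simp
  finally have "(\<integral>w. indicator B (snd (obs_XZ w)) * obs_Y w \<partial>law h) = 0" .
  then show "(\<integral>w. indicator B (obs_Z w) * obs_Y w \<partial>law h) = (\<integral>w. indicator B (obs_Z w) * 0 \<partial>law h)"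
    by (simp add: obs_Z_def obs_XZ_def)
qed auto

lemma tau_law: "tau (law h) = (\<integral>v. (h v)\<^sup>2 \<partial>uniform_cube)"
proof -
  have "tau (law h) = (\<integral>w. (h (obs_XZ w))\<^sup>2 \<partial>law h)"
    unfolding tau_def
  proof (rule integral_cong_AE)
    show "AE w in law h. (real_cond_exp (law h) (gen_sigma (law h) obs_XZ) obs_Y w
        - real_cond_exp (law h) (gen_sigma (law h) obs_Z) obs_Y w)\<^sup>2 = (h (obs_XZ w))\<^sup>2"
      using cond_mean_version_XZ cond_mean_version_Z unfolding cond_mean_version_def
      by (auto elim: eventually_elim2)
  qed (auto intro!: borel_measurable_cond_exp2)
  also have "\<dots> = (\<integral>v. (h v)\<^sup>2 \<partial>uniform_cube)"
    by (rule integral_law_XZ[where B=1]) (use h_bound in \<open>auto simp: abs_square_le_1\<close>)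
  finally show ?thesis .
qed

lemma law_in_model_class:
  assumes "1 \<le> C" "0 < c" "c \<le> 1" "h \<in> holder_space s" "holder_norm s h \<le> C"
  shows "law h \<in> model_class s C c \<delta>"
proof -
  interpret L: prob_space "law h" by (rule prob_space_law)
  interpret finite_measure_subalgebra "law h" "gen_sigma (law h) obs_XZ" by (rule subalgebra_gen_sigma) simp
  \<comment> \<open>A function of Y equal to 1 at both signs has conditional expectation 1; this
    covers the second moment and the moment of order 2 + \<delta> at once.\<close>
  have one: "AE w in law h. nn_cond_exp (law h) (gen_sigma (law h) obs_XZ) (\<lambda>w. ennreal (f (obs_Y w))) w = 1"
    if [measurable]: "f \<in> borel_measurable borel" and "f 1 = 1" "f (-1) = 1" for f :: "real \<Rightarrow> real"
  proof -
    have "AE w in law h. ennreal (f (obs_Y w)) = 1"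
      using AE_law by eventually_elim (use that in auto)
    then have "AE w in law h. nn_cond_exp (law h) (gen_sigma (law h) obs_XZ) (\<lambda>w. ennreal (f (obs_Y w))) w
        = nn_cond_exp (law h) (gen_sigma (law h) obs_XZ) (\<lambda>_. 1) w"
      by (intro nn_cond_exp_cong) auto
    moreover have "AE w in law h. 1 = nn_cond_exp (law h) (gen_sigma (law h) obs_XZ) (\<lambda>_. 1) w"
      by (rule nn_cond_exp_F_meas) simp
    ultimately show ?thesis by eventually_elim simp
  qed
  have p: "distributed (law h) lborel obs_XZ (\<lambda>v. ennreal 1 * indicator unit_cube v)"
    unfolding distributed_def using distr_law_XZ by (auto simp: uniform_cube_def measurable_lborel1)
  \<comment> \<open>With joint density 1, this is the denominator of the conditional density of X
    given Z, which is therefore constantly 1.\<close>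
  have lint: "(LINT x:(unit_cube :: (real^'dx) set)|lborel. 1 :: real) = 1"
    using emeasure_lborel_unit_cube[where 'a="real^'dx"]
    by (simp add: set_lebesgue_integral_def measure_def)
  have const: "(\<lambda>_::real^'dz. a) \<in> holder_space s" "holder_norm s (\<lambda>_::real^'dz. a) \<le> C"
    if "a = 0 \<or> a = 1" for a :: real
    using holder_space_const[of "\<lambda>_. a" a C s] holder_norm_const[of "\<lambda>_. a" a C s] that assms by auto
  have XZ: "AE w in law h. obs_XZ w \<in> unit_cube" using AE_law by eventually_elim simp
  have Y: "integrable (law h) obs_Y" by (rule integrable_law[where B=1]) auto
  have moment2: "AE w in law h. nn_cond_exp (law h) (gen_sigma (law h) obs_XZ)
      (\<lambda>w. ennreal ((obs_Y w - 0)\<^sup>2)) w \<ge> ennreal c"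
    using one[of "\<lambda>y. (y - 0)\<^sup>2"] assms by (auto elim!: eventually_mono)
  have moment: "AE w in law h. nn_cond_exp (law h) (gen_sigma (law h) obs_XZ)
      (\<lambda>w. ennreal (\<bar>obs_Y w - 0\<bar> powr (2 + \<delta>))) w \<le> ennreal C"
    using one[of "\<lambda>y. \<bar>y - 0\<bar> powr (2 + \<delta>)"] assms by (auto elim!: eventually_mono)
  show ?thesis
    unfolding model_class_def mem_Collect_eq
    \<comment> \<open>The witnesses are the joint density 1, m = 0 and g = h.\<close>
    by (intro conjI; (rule exI[of _ "\<lambda>_. 1"], rule exI[of _ "\<lambda>_. 0"], rule exI[of _ h])?)
      (use XZ Y moment2 moment cond_mean_version_XZ cond_mean_version_Z p assms L.prob_space_axioms
        in \<open>simp_all add: lint const\<close>)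
qed

end

section \<open>Likelihood ratios\<close>

text \<open>Expresses every sample law as a density against the sample law of the null, so that all
  rejection probabilities become integrals over one space. Boxes determine the product measure, and
  on them both sides factorise.\<close>

lemma PiM_density:
  assumes I: "finite I" and "sigma_finite_measure N" "sigma_finite_measure (density N f)"
    and f [measurable]: "f \<in> borel_measurable N"
  shows "Pi\<^sub>M I (\<lambda>_. density N f) = density (Pi\<^sub>M I (\<lambda>_. N)) (\<lambda>\<omega>. \<Prod>i\<in>I. f (\<omega> i))"
proof -
  interpret N: product_sigma_finite "\<lambda>_. N" using assms by (simp add: product_sigma_finite_def)
  interpret D: product_sigma_finite "\<lambda>_. density N f" using assms by (simp add: product_sigma_finite_def)
  show ?thesis
  proof (rule D.PiM_eqI[OF I, symmetric])
    show "sets (density (Pi\<^sub>M I (\<lambda>_. N)) (\<lambda>\<omega>. \<Prod>i\<in>I. f (\<omega> i))) = sets (Pi\<^sub>M I (\<lambda>_. density N f))"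
      by (auto intro!: sets_PiM_cong)
    fix A :: "'a \<Rightarrow> 'b set" assume "\<And>i. i \<in> I \<Longrightarrow> A i \<in> sets (density N f)"
    then have A: "\<And>i. i \<in> I \<Longrightarrow> A i \<in> sets N" by simp
    have "emeasure (density (Pi\<^sub>M I (\<lambda>_. N)) (\<lambda>\<omega>. \<Prod>i\<in>I. f (\<omega> i))) (Pi\<^sub>E I A) =
        (\<integral>\<^sup>+\<omega>. (\<Prod>i\<in>I. f (\<omega> i)) * indicator (Pi\<^sub>E I A) \<omega> \<partial>Pi\<^sub>M I (\<lambda>_. N))"
      using A I by (subst emeasure_density) (auto intro!: sets_PiM_I_finite)
    also have "\<dots> = (\<integral>\<^sup>+\<omega>. (\<Prod>i\<in>I. f (\<omega> i) * indicator (A i) (\<omega> i)) \<partial>Pi\<^sub>M I (\<lambda>_. N))"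
    proof (rule nn_integral_cong)
      fix \<omega> assume "\<omega> \<in> space (Pi\<^sub>M I (\<lambda>_. N))"
      then have "\<omega> \<in> extensional I" by (auto simp: space_PiM PiE_def)
      then have "indicator (Pi\<^sub>E I A) \<omega> = (\<Prod>i\<in>I. indicator (A i) (\<omega> i) :: ennreal)"
        using I by (auto simp: indicator_def PiE_def Pi_def intro: prod_zero)
      then show "(\<Prod>i\<in>I. f (\<omega> i)) * indicator (Pi\<^sub>E I A) \<omega> = (\<Prod>i\<in>I. f (\<omega> i) * indicator (A i) (\<omega> i))"
        by (simp add: prod.distrib)
    qed
    also have "\<dots> = (\<Prod>i\<in>I. \<integral>\<^sup>+x. f x * indicator (A i) x \<partial>N)"
      by (rule N.product_nn_integral_prod) (use I A in auto)
    also have "\<dots> = (\<Prod>i\<in>I. emeasure (density N f) (A i))"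
      using A by (intro prod.cong) (auto simp: emeasure_density)
    finally show "emeasure (density (Pi\<^sub>M I (\<lambda>_. N)) (\<lambda>\<omega>. \<Prod>i\<in>I. f (\<omega> i))) (Pi\<^sub>E I A) =
      (\<Prod>i\<in>I. emeasure (density N f) (A i))" .
  qed
qed

section \<open>Likelihoods, their second moments and rejection probabilities\<close>

definition likelihood ::
  "((real^'dx) \<times> (real^'dz) \<Rightarrow> real) \<Rightarrow> nat \<Rightarrow> (nat \<Rightarrow> ('dx::finite, 'dz::finite) obs) \<Rightarrow> real" where
  "likelihood h n \<omega> = (\<Prod>i<n. 1 + sgn (obs_Y (\<omega> i)) * h (obs_XZ (\<omega> i)))"

lemma regression_function_0: "regression_function (\<lambda>_. 0)"
  by unfold_locales auto

lemma likelihood_0: "likelihood (\<lambda>_. 0) n \<omega> = 1"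
  by (simp add: likelihood_def)

text \<open>By independence it suffices to treat one observation, where averaging (1 + h)(1 + h')
  and (1 - h)(1 - h') cancels the linear terms and leaves 1 + h h'. The case \<open>h' = 0\<close>
  gives integrability and mean 1 of a single likelihood.\<close>

lemma
  fixes h h' :: "(real^'dx::finite) \<times> (real^'dz::finite) \<Rightarrow> real"
  assumes "regression_function h" "regression_function h'"
  shows integrable_likelihood_mult:
      "integrable (Pi\<^sub>M {..<n} (\<lambda>_. null_law)) (\<lambda>\<omega>. likelihood h n \<omega> * likelihood h' n \<omega>)"
    and integral_likelihood_mult:
      "(\<integral>\<omega>. likelihood h n \<omega> * likelihood h' n \<omega> \<partial>Pi\<^sub>M {..<n} (\<lambda>_. null_law)) =
        (1 + (\<integral>v. h v * h' v \<partial>uniform_cube)) ^ n"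
proof -
  interpret h: regression_function h by fact
  interpret h': regression_function h' by fact
  interpret N: prob_space "null_law :: ('dx, 'dz) obs measure" by (rule prob_space_null_law)
  interpret U: prob_space "uniform_cube :: ((real^'dx) \<times> (real^'dz)) measure" by (rule prob_space_uniform_cube)
  interpret P: product_sigma_finite "\<lambda>_::nat. null_law :: ('dx, 'dz) obs measure"
    by unfold_locales
  define f :: "('dx, 'dz) obs \<Rightarrow> real" where
    "f w = (1 + sgn (obs_Y w) * h (obs_XZ w)) * (1 + sgn (obs_Y w) * h' (obs_XZ w))" for w
  have [measurable]: "f \<in> borel_measurable borel" unfolding f_def [abs_def] by measurable
  have f_le: "\<bar>f w\<bar> \<le> 2 * 2" for w
    unfolding f_def abs_mult by (intro mult_mono h.density_bounds h'.density_bounds) auto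
  have f: "integrable null_law f" by (rule integrable_null_law[OF _ f_le]) auto
  have eq: "likelihood h n \<omega> * likelihood h' n \<omega> = (\<Prod>i<n. f (\<omega> i))" for \<omega>
    by (simp add: likelihood_def f_def prod.distrib)
  show "integrable (Pi\<^sub>M {..<n} (\<lambda>_. null_law)) (\<lambda>\<omega>. likelihood h n \<omega> * likelihood h' n \<omega>)"
    unfolding eq by (rule P.product_integrable_prod) (use f in auto)
  have hh: "integrable uniform_cube (\<lambda>v. h v * h' v)"
  proof (rule U.integrable_const_bound[where B=1])
    have "norm (h v * h' v) \<le> 1" for v
      using mult_mono[OF h.h_bound[of v] h'.h_bound[of v]] by (simp add: abs_mult)
    then show "AE v in uniform_cube. norm (h v * h' v) \<le> 1" by simp
  qed measurable
  have avg: "(f (assemble (v, 1)) + f (assemble (v, -1))) / 2 = 1 + h v * h' v" for v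
    by (simp add: f_def field_simps)
  have "(\<integral>w. f w \<partial>null_law) = (\<integral>v. (f (assemble (v, 1)) + f (assemble (v, -1))) / 2 \<partial>uniform_cube)"
    by (rule integral_null_law[OF _ f_le]) simp
  also have "\<dots> = (\<integral>v. 1 + h v * h' v \<partial>uniform_cube)"
    by (simp only: avg)
  also have "\<dots> = 1 + (\<integral>v. h v * h' v \<partial>uniform_cube)"
    using hh U.prob_space by simp
  finally show "(\<integral>\<omega>. likelihood h n \<omega> * likelihood h' n \<omega> \<partial>Pi\<^sub>M {..<n} (\<lambda>_. null_law)) =
        (1 + (\<integral>v. h v * h' v \<partial>uniform_cube)) ^ n"
    unfolding eq by (subst P.product_integral_prod) (use f in auto)
qed

lemma rejection_prob_law:
  fixes h :: "(real^'dx::finite) \<times> (real^'dz::finite) \<Rightarrow> real"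
  assumes "regression_function h"
    and \<phi>: "\<phi> \<in> Pi\<^sub>M {..<n} (\<lambda>_. borel) \<rightarrow>\<^sub>M count_space {0, 1::nat}"
  shows "rejection_prob (law h) n \<phi> =
    (\<integral>\<omega>. indicator (\<phi> -` {1}) \<omega> * likelihood h n \<omega> \<partial>Pi\<^sub>M {..<n} (\<lambda>_. null_law))" (is ?thesis1)
    and "integrable (Pi\<^sub>M {..<n} (\<lambda>_. null_law)) (\<lambda>\<omega>. indicator (\<phi> -` {1}) \<omega> * likelihood h n \<omega>)" (is ?thesis2)
proof -
  interpret h: regression_function h by fact
  interpret N: prob_space "null_law :: ('dx, 'dz) obs measure" by (rule prob_space_null_law)
  interpret L: prob_space "law h" by (rule h.prob_space_law)
  let ?N = "Pi\<^sub>M {..<n} (\<lambda>_. null_law :: ('dx, 'dz) obs measure)"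
  \<comment> \<open>The preimage of 1 under \<phi> may contain points outside the sample space,
    about which measurability says nothing; \<open>R\<close> is the part inside.\<close>
  define R where "R = {\<omega> \<in> space ?N. \<phi> \<omega> = 1}"
  have sets: "sets ?N = sets (Pi\<^sub>M {..<n} (\<lambda>_. borel))" by (rule sets_PiM_cong) auto
  have space: "space ?N = space (Pi\<^sub>M {..<n} (\<lambda>_. law h))" by (simp add: space_PiM)
  have "\<phi> -` {1} \<inter> space (Pi\<^sub>M {..<n} (\<lambda>_. borel)) \<in> sets (Pi\<^sub>M {..<n} (\<lambda>_. borel))"
    by (rule measurable_sets[OF \<phi>]) auto
  moreover have "\<phi> -` {1} \<inter> space (Pi\<^sub>M {..<n} (\<lambda>_. borel)) = R"
    by (auto simp: R_def space_PiM)
  ultimately have R [measurable]: "R \<in> sets ?N" by (simp add: sets)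
  have ind: "indicator (\<phi> -` {1}) \<omega> = (indicator R \<omega> :: real)" if "\<omega> \<in> space ?N" for \<omega>
    using that by (simp add: R_def indicator_def)
  have int: "integrable ?N (\<lambda>\<omega>. likelihood h n \<omega>)"
    using integrable_likelihood_mult[OF assms(1) regression_function_0, of n] by (simp add: likelihood_0)
  then have meas [measurable]: "(\<lambda>\<omega>. likelihood h n \<omega>) \<in> borel_measurable ?N" by auto
  have nonneg: "0 \<le> likelihood h n \<omega>" for \<omega>
    unfolding likelihood_def by (intro prod_nonneg ballI h.density_bounds)
  have int_R: "integrable ?N (\<lambda>\<omega>. indicator R \<omega> * likelihood h n \<omega>)"
    using integrable_mult_indicator[OF R int] by simp
  then show ?thesis2
    by (subst Bochner_Integration.integrable_cong[OF refl]) (simp_all add: ind del: One_nat_def)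
  have "Pi\<^sub>M {..<n} (\<lambda>_. law h) = density ?N (\<lambda>\<omega>. ennreal (likelihood h n \<omega>))"
  proof -
    have "Pi\<^sub>M {..<n} (\<lambda>_. law h) =
        density ?N (\<lambda>\<omega>. \<Prod>i<n. ennreal (1 + sgn (obs_Y (\<omega> i)) * h (obs_XZ (\<omega> i))))"
      unfolding law_def
      by (rule PiM_density) (use N.sigma_finite_measure_axioms L.sigma_finite_measure_axioms in \<open>auto simp: law_def\<close>)
    also have "(\<lambda>\<omega>. \<Prod>i<n. ennreal (1 + sgn (obs_Y (\<omega> i)) * h (obs_XZ (\<omega> i)))) = (\<lambda>\<omega>. ennreal (likelihood h n \<omega>))"
      unfolding likelihood_def by (subst prod_ennreal) (auto intro!: h.density_bounds)
    finally show ?thesis .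
  qed
  then have "rejection_prob (law h) n \<phi> = measure (density ?N (\<lambda>\<omega>. ennreal (likelihood h n \<omega>))) R"
    unfolding rejection_prob_def R_def space by simp
  also have "\<dots> = (\<integral>\<omega>. indicator R \<omega> * likelihood h n \<omega> \<partial>?N)"
  proof -
    have "emeasure (density ?N (\<lambda>\<omega>. ennreal (likelihood h n \<omega>))) R =
        (\<integral>\<^sup>+\<omega>. ennreal (indicator R \<omega> * likelihood h n \<omega>) \<partial>?N)"
      by (subst emeasure_density) (auto intro!: nn_integral_cong split: split_indicator)
    also have "\<dots> = ennreal (\<integral>\<omega>. indicator R \<omega> * likelihood h n \<omega> \<partial>?N)"
      by (rule nn_integral_eq_integral[OF int_R]) (simp add: nonneg)
    finally show ?thesis
      unfolding measure_def by (simp add: nonneg)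
  qed
  also have "\<dots> = (\<integral>\<omega>. indicator (\<phi> -` {1}) \<omega> * likelihood h n \<omega> \<partial>?N)"
    by (rule Bochner_Integration.integral_cong) (simp_all add: ind del: One_nat_def)
  finally show ?thesis1 .
qed

text \<open>
  Le Cam's argument against the mixture with likelihood ratio \<open>W\<close>: the bound
  \<open>\<bar>W - 1\<bar> \<le> 1/4 + (W - 1)\<^sup>2\<close> converts the second moment of \<open>W\<close> into a bound on the power.
\<close>

lemma exists_rejection_prob_le:
  fixes h :: "'i \<Rightarrow> (real^'dx::finite) \<times> (real^'dz::finite) \<Rightarrow> real"
  assumes \<Xi>: "finite \<Xi>" "\<Xi> \<noteq> {}" and h: "\<And>\<xi>. \<xi> \<in> \<Xi> \<Longrightarrow> regression_function (h \<xi>)"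
    and \<phi>: "\<phi> \<in> Pi\<^sub>M {..<n} (\<lambda>_. borel) \<rightarrow>\<^sub>M count_space {0, 1::nat}"
    and chi: "(\<Sum>\<xi>\<in>\<Xi>. \<Sum>\<xi>'\<in>\<Xi>. (1 + (\<integral>v. h \<xi> v * h \<xi>' v \<partial>uniform_cube)) ^ n) \<le> (5 / 4) * (real (card \<Xi>))\<^sup>2"
  shows "\<exists>\<xi>\<in>\<Xi>. rejection_prob (law (h \<xi>)) n \<phi> \<le> rejection_prob null_law n \<phi> + 1 / 2"
proof (rule ccontr)
  interpret N: prob_space "null_law :: ('dx, 'dz) obs measure" by (rule prob_space_null_law)
  let ?N = "Pi\<^sub>M {..<n} (\<lambda>_. null_law :: ('dx, 'dz) obs measure)"
  interpret NN: prob_space ?N by (intro prob_space_PiM prob_space_null_law)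
  define c where "c = real (card \<Xi>)"
  have c: "0 < c" using \<Xi> by (simp add: c_def card_gt_0_iff)
  define W where "W \<omega> = (\<Sum>\<xi>\<in>\<Xi>. likelihood (h \<xi>) n \<omega>) / c" for \<omega>
  let ?R = "\<lambda>\<omega>. indicator (\<phi> -` {1}) \<omega> :: real"
  assume "\<not> ?thesis"
  \<comment> \<open>If every member of the family were rejected more often, so would be their
    average, whose likelihood ratio is \<open>W\<close>.\<close>
  then have "(\<Sum>\<xi>\<in>\<Xi>. rejection_prob null_law n \<phi> + 1 / 2) < (\<Sum>\<xi>\<in>\<Xi>. rejection_prob (law (h \<xi>)) n \<phi>)"
    by (intro sum_strict_mono \<Xi>) auto
  then have gt: "rejection_prob null_law n \<phi> + 1 / 2 < (\<Sum>\<xi>\<in>\<Xi>. rejection_prob (law (h \<xi>)) n \<phi>) / c"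
    using c by (simp add: c_def field_simps)
  have int: "integrable ?N (likelihood (h \<xi>) n)" "(\<integral>\<omega>. likelihood (h \<xi>) n \<omega> \<partial>?N) = 1" if "\<xi> \<in> \<Xi>" for \<xi>
    using integrable_likelihood_mult[OF h[OF that] regression_function_0, of n]
      integral_likelihood_mult[OF h[OF that] regression_function_0, of n] by (simp_all add: likelihood_0)
  have W_int: "integrable ?N W" and W_eq: "(\<integral>\<omega>. W \<omega> \<partial>?N) = 1"
    unfolding W_def [abs_def] using int c by (simp_all add: c_def)
  have W2: "(W \<omega>)\<^sup>2 = (\<Sum>\<xi>\<in>\<Xi>. \<Sum>\<xi>'\<in>\<Xi>. likelihood (h \<xi>) n \<omega> * likelihood (h \<xi>') n \<omega>) / c\<^sup>2" for \<omega>
    by (simp add: W_def power_divide power2_eq_square sum_product)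
  have W2_int: "integrable ?N (\<lambda>\<omega>. (W \<omega>)\<^sup>2)"
  proof -
    have "integrable ?N (\<lambda>\<omega>. \<Sum>\<xi>\<in>\<Xi>. \<Sum>\<xi>'\<in>\<Xi>. likelihood (h \<xi>) n \<omega> * likelihood (h \<xi>') n \<omega>)"
      by (intro Bochner_Integration.integrable_sum integrable_likelihood_mult h)
    then show ?thesis unfolding W2 by simp
  qed
  have "(\<integral>\<omega>. (W \<omega>)\<^sup>2 \<partial>?N) =
      (\<Sum>\<xi>\<in>\<Xi>. \<Sum>\<xi>'\<in>\<Xi>. (1 + (\<integral>v. h \<xi> v * h \<xi>' v \<partial>uniform_cube)) ^ n) / c\<^sup>2"
  proof -
    have "(\<integral>\<omega>. (\<Sum>\<xi>\<in>\<Xi>. \<Sum>\<xi>'\<in>\<Xi>. likelihood (h \<xi>) n \<omega> * likelihood (h \<xi>') n \<omega>) \<partial>?N) =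
        (\<Sum>\<xi>\<in>\<Xi>. \<integral>\<omega>. (\<Sum>\<xi>'\<in>\<Xi>. likelihood (h \<xi>) n \<omega> * likelihood (h \<xi>') n \<omega>) \<partial>?N)"
      by (intro Bochner_Integration.integral_sum Bochner_Integration.integrable_sum integrable_likelihood_mult h)
    also have "\<dots> = (\<Sum>\<xi>\<in>\<Xi>. \<Sum>\<xi>'\<in>\<Xi>. \<integral>\<omega>. likelihood (h \<xi>) n \<omega> * likelihood (h \<xi>') n \<omega> \<partial>?N)"
      by (intro sum.cong refl Bochner_Integration.integral_sum integrable_likelihood_mult h)
    also have "\<dots> = (\<Sum>\<xi>\<in>\<Xi>. \<Sum>\<xi>'\<in>\<Xi>. (1 + (\<integral>v. h \<xi> v * h \<xi>' v \<partial>uniform_cube)) ^ n)"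
      by (intro sum.cong refl integral_likelihood_mult h)
    finally show ?thesis unfolding W2 by simp
  qed
  also have "\<dots> \<le> 5 / 4" using chi c by (simp add: c_def field_simps)
  finally have W2_le: "(\<integral>\<omega>. (W \<omega>)\<^sup>2 \<partial>?N) \<le> 5 / 4" .
  have RW: "?R \<omega> * W \<omega> = (\<Sum>\<xi>\<in>\<Xi>. ?R \<omega> * likelihood (h \<xi>) n \<omega>) / c" for \<omega>
    by (simp add: W_def sum_distrib_left)
  have RW_int: "integrable ?N (\<lambda>\<omega>. ?R \<omega> * W \<omega>)"
    unfolding RW using rejection_prob_law(2)[OF h \<phi>] by auto
  have RW_eq: "(\<integral>\<omega>. ?R \<omega> * W \<omega> \<partial>?N) = (\<Sum>\<xi>\<in>\<Xi>. rejection_prob (law (h \<xi>)) n \<phi>) / c"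
    unfolding RW using rejection_prob_law[OF h \<phi>] by (simp add: Bochner_Integration.integral_sum)
  have R_int: "integrable ?N ?R" and R_eq: "(\<integral>\<omega>. ?R \<omega> \<partial>?N) = rejection_prob null_law n \<phi>"
    using rejection_prob_law[OF regression_function_0 \<phi>] by (simp_all add: likelihood_0 law_0)
  have "?R \<omega> * W \<omega> - ?R \<omega> \<le> 5 / 4 + (W \<omega>)\<^sup>2 - 2 * W \<omega>" for \<omega>
  proof -
    \<comment> \<open>The right-hand side above is 1/4 + (W - 1)^2. The first square settles the
      points of rejection, where the claim reads W - 1 \<le> 1/4 + (W - 1)^2; the second settles the
      others.\<close>
    have "0 \<le> (W \<omega> - 3 / 2)\<^sup>2" "0 \<le> (W \<omega> - 1)\<^sup>2" by auto
    then show ?thesis by (auto simp: indicator_def power2_eq_square algebra_simps)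
  qed
  then have "(\<integral>\<omega>. ?R \<omega> * W \<omega> - ?R \<omega> \<partial>?N) \<le> (\<integral>\<omega>. 5 / 4 + (W \<omega>)\<^sup>2 - 2 * W \<omega> \<partial>?N)"
    using RW_int R_int W2_int W_int by (intro integral_mono) auto
  \<comment> \<open>5/4 + 5/4 - 2 = 1/2, as \<open>W\<close> has mean 1.\<close>
  also have "\<dots> \<le> 1 / 2"
    using W2_int W_int W_eq W2_le NN.prob_space by simp
  finally have "(\<integral>\<omega>. ?R \<omega> * W \<omega> - ?R \<omega> \<partial>?N) \<le> 1 / 2" .
  moreover have "(\<integral>\<omega>. ?R \<omega> * W \<omega> - ?R \<omega> \<partial>?N) = (\<integral>\<omega>. ?R \<omega> * W \<omega> \<partial>?N) - (\<integral>\<omega>. ?R \<omega> \<partial>?N)"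
    by (rule Bochner_Integration.integral_diff[OF RW_int R_int])
  ultimately show False
    using gt RW_eq R_eq by linarith
qed

section \<open>Averaging over the signs\<close>

lemma sum_exp_signs:
  fixes \<xi> :: "'a \<Rightarrow> real"
  assumes "finite S" and \<xi>: "\<And>J. J \<in> S \<Longrightarrow> \<xi> J \<in> {-1, 1}"
  shows "(\<Sum>\<xi>'\<in>S \<rightarrow>\<^sub>E {-1, 1}. exp (\<theta> * (\<Sum>J\<in>S. \<xi> J * \<xi>' J))) = (exp \<theta> + exp (- \<theta>)) ^ card S"
proof -
  have "(\<Sum>\<xi>'\<in>S \<rightarrow>\<^sub>E {-1, 1}. exp (\<theta> * (\<Sum>J\<in>S. \<xi> J * \<xi>' J))) =
      (\<Sum>\<xi>'\<in>S \<rightarrow>\<^sub>E {-1, 1}. \<Prod>J\<in>S. exp (\<theta> * (\<xi> J * \<xi>' J)))"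
    by (simp add: sum_distrib_left exp_sum \<open>finite S\<close>)
  \<comment> \<open>The exponential is a product over the coordinates, so the sum over all sign
    patterns factorises. Each factor is the same for both values of \<open>\<xi> J\<close>, hence
    the result does not depend on \<xi>.\<close>
  also have "\<dots> = (\<Prod>J\<in>S. \<Sum>y\<in>{-1, 1}. exp (\<theta> * (\<xi> J * y)))"
    by (rule prod_sum_PiE[symmetric]) (use \<open>finite S\<close> in auto)
  also have "\<dots> = (\<Prod>J\<in>S. exp \<theta> + exp (- \<theta>))"
    by (rule prod.cong) (use \<xi> in \<open>force simp: add.commute\<close>)+
  finally show ?thesis by simp
qed

lemma exp_plus_exp_minus_le:
  fixes \<theta> :: real
  assumes "0 \<le> \<theta>" "\<theta> \<le> 1"
  shows "exp \<theta> + exp (- \<theta>) \<le> 2 * exp (\<theta>\<^sup>2)"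
proof -
  \<comment> \<open>The product is 1 + \<theta>^3.\<close>
  have "1 \<le> (1 + \<theta>) * (1 - \<theta> + \<theta>\<^sup>2)"
    using assms by (simp add: algebra_simps power2_eq_square)
  then have "inverse (1 + \<theta>) \<le> 1 - \<theta> + \<theta>\<^sup>2"
    using assms by (simp add: field_simps)
  moreover have "exp (- \<theta>) \<le> inverse (1 + \<theta>)"
    unfolding exp_minus by (intro le_imp_inverse_le exp_ge_add_one_self) (use assms in auto)
  ultimately have "exp \<theta> + exp (- \<theta>) \<le> 2 * (1 + \<theta>\<^sup>2)"
    using exp_bound[OF assms] by simp
  also have "\<dots> \<le> 2 * exp (\<theta>\<^sup>2)" by (intro mult_left_mono exp_ge_add_one_self) simp
  finally show ?thesis .
qed

text \<open>The bound \<open>real (card S) * \<mu> \<le> 1\<close> keeps the base nonnegative, so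
  that 1 + x \<le> exp x may be raised to the power n. With \<theta> = n \<mu> at most 1, each inner
  sum is at most 2^N exp(N \<theta>^2), and N \<theta>^2 \<le> 1/16 makes the exponential at most
  5/4.\<close>

lemma sum_sum_power_signs_le:
  fixes S :: "'a set"
  assumes S: "finite S" and \<mu>: "0 \<le> \<mu>" "real (card S) * \<mu> \<le> 1"
    and \<theta>: "real n * \<mu> \<le> 1" "real (card S) * (real n * \<mu>)\<^sup>2 \<le> 1 / 16"
  shows "(\<Sum>\<xi>\<in>S \<rightarrow>\<^sub>E {-1, 1::real}. \<Sum>\<xi>'\<in>S \<rightarrow>\<^sub>E {-1, 1}. (1 + \<mu> * (\<Sum>J\<in>S. \<xi> J * \<xi>' J)) ^ n)
    \<le> (5 / 4) * (real (card (S \<rightarrow>\<^sub>E {-1, 1::real})))\<^sup>2"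
proof -
  define \<theta> where "\<theta> = real n * \<mu>"
  have card: "card (S \<rightarrow>\<^sub>E {-1, 1::real}) = 2 ^ card S" using S by (simp add: card_PiE numeral_2_eq_2)
  have "(\<Sum>\<xi>'\<in>S \<rightarrow>\<^sub>E {-1, 1}. (1 + \<mu> * (\<Sum>J\<in>S. \<xi> J * \<xi>' J)) ^ n) \<le> (5 / 4) * 2 ^ card S"
    if \<xi>: "\<xi> \<in> S \<rightarrow>\<^sub>E {-1, 1::real}" for \<xi>
  proof -
    have "(1 + \<mu> * (\<Sum>J\<in>S. \<xi> J * \<xi>' J)) ^ n \<le> exp (\<theta> * (\<Sum>J\<in>S. \<xi> J * \<xi>' J))"
      if \<xi>': "\<xi>' \<in> S \<rightarrow>\<^sub>E {-1, 1::real}" for \<xi>'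
    proof -
      have "\<bar>\<Sum>J\<in>S. \<xi> J * \<xi>' J\<bar> \<le> (\<Sum>J\<in>S. 1)"
        using PiE_mem[OF \<xi>] PiE_mem[OF \<xi>'] by (intro order_trans[OF sum_abs] sum_mono) (fastforce simp: abs_mult)
      then have "\<bar>\<mu> * (\<Sum>J\<in>S. \<xi> J * \<xi>' J)\<bar> \<le> \<mu> * card S"
        using \<mu> by (simp add: abs_mult mult_left_mono)
      then have "0 \<le> 1 + \<mu> * (\<Sum>J\<in>S. \<xi> J * \<xi>' J)" using \<mu> by (simp add: mult.commute abs_le_iff)
      then have "(1 + \<mu> * (\<Sum>J\<in>S. \<xi> J * \<xi>' J)) ^ n \<le> exp (\<mu> * (\<Sum>J\<in>S. \<xi> J * \<xi>' J)) ^ n"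
        by (intro power_mono exp_ge_add_one_self)
      then show ?thesis by (simp add: \<theta>_def exp_of_nat_mult[symmetric] mult.assoc)
    qed
    then have "(\<Sum>\<xi>'\<in>S \<rightarrow>\<^sub>E {-1, 1}. (1 + \<mu> * (\<Sum>J\<in>S. \<xi> J * \<xi>' J)) ^ n) \<le> (exp \<theta> + exp (- \<theta>)) ^ card S"
      using PiE_mem[OF \<xi>] by (subst sum_exp_signs[OF S, symmetric, of \<xi>]) (auto intro!: sum_mono)
    also have "\<dots> \<le> (2 * exp (\<theta>\<^sup>2)) ^ card S"
      using \<mu> \<open>real n * \<mu> \<le> 1\<close> by (intro power_mono exp_plus_exp_minus_le) (auto simp: \<theta>_def)
    also have "\<dots> = 2 ^ card S * exp (real (card S) * \<theta>\<^sup>2)"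
      by (simp add: power_mult_distrib exp_of_nat_mult)
    also have "\<dots> \<le> 2 ^ card S * (5 / 4)"
    proof (rule mult_left_mono)
      have "exp (real (card S) * \<theta>\<^sup>2) \<le> exp (1 / 16)" using assms by (simp add: \<theta>_def)
      also have "\<dots> \<le> 5 / 4" using exp_bound[of "1/16::real"] by (simp add: power2_eq_square)
      finally show "exp (real (card S) * \<theta>\<^sup>2) \<le> 5 / 4" .
    qed simp
    finally show ?thesis by simp
  qed
  then have "(\<Sum>\<xi>\<in>S \<rightarrow>\<^sub>E {-1, 1::real}. \<Sum>\<xi>'\<in>S \<rightarrow>\<^sub>E {-1, 1}. (1 + \<mu> * (\<Sum>J\<in>S. \<xi> J * \<xi>' J)) ^ n)
      \<le> (\<Sum>\<xi>\<in>S \<rightarrow>\<^sub>E {-1, 1::real}. (5 / 4) * 2 ^ card S)"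
    by (rule sum_mono)
  then show ?thesis by (simp add: card power2_eq_square)
qed

section \<open>Overlaps of the alternatives\<close>

lemma integral_lborel_prod:
  fixes f :: "'a::euclidean_space \<Rightarrow> real \<Rightarrow> real"
  assumes "\<And>b. b \<in> Basis \<Longrightarrow> integrable lborel (f b)"
  shows "(\<integral>x. (\<Prod>b\<in>Basis. f b (x \<bullet> b)) \<partial>lborel) = (\<Prod>b\<in>Basis. \<integral>t. f b t \<partial>lborel)"
proof -
  interpret product_sigma_finite "\<lambda>_::'a. lborel :: real measure"
    by unfold_locales
  have [measurable]: "f b \<in> borel_measurable borel" if "b \<in> Basis" for b
    using borel_measurable_integrable[OF assms[OF that]] by simp
  have "(\<integral>x. (\<Prod>b\<in>Basis. f b (x \<bullet> b)) \<partial>lborel) =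
      (\<integral>x. (\<Prod>b\<in>Basis. f b ((\<Sum>c\<in>Basis. x c *\<^sub>R c) \<bullet> b)) \<partial>(\<Pi>\<^sub>M b\<in>Basis. lborel))"
    by (subst lborel_eq, subst integral_distr) auto
  also have "\<dots> = (\<integral>x. (\<Prod>b\<in>Basis. f b (x b)) \<partial>(\<Pi>\<^sub>M b\<in>Basis. lborel))"
    by (intro Bochner_Integration.integral_cong prod.cong) auto
  also have "\<dots> = (\<Prod>b\<in>Basis. \<integral>t. f b t \<partial>lborel)"
    by (rule product_integral_prod) (use assms in auto)
  finally show ?thesis .
qed

locale centred_bump = smooth_bump +
  assumes u_integral: "(\<integral>t. u 0 t \<partial>lborel) = 0"
begin

lemma u_measurable [measurable]: "u 0 \<in> borel_measurable borel"
  using u_deriv[of 0] by (intro borel_measurable_continuous_onI)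
    (auto simp: continuous_on_eq_continuous_at intro: DERIV_isCont)

text \<open>The exponent is a successor because the power must vanish off the support; the zeroth
  power is the constant 1.\<close>

lemma integrable_u_affine:
  assumes "k \<noteq> 0" shows "integrable lborel (\<lambda>t. u 0 (k * t - j) ^ Suc m)"
proof -
  have "\<bar>u 0 t\<bar> ^ Suc m \<le> K ^ Suc m * indicator {0..1} t" for t
    using power_mono[OF u_bound[of 0 t], of "Suc m"] u_support[of t 0] by (cases "t \<in> {0<..<1}") auto
  then have "norm (u 0 t ^ Suc m) \<le> norm (K ^ Suc m * indicator {0..1} t)" for t
    unfolding real_norm_def power_abs by (rule order_trans[OF _ abs_ge_self])
  then have "integrable lborel (\<lambda>t. u 0 t ^ Suc m)"
    by (intro Bochner_Integration.integrable_bound[OF _ _ AE_I2, of lborel "\<lambda>t. K ^ Suc m * indicator {0..1} t" "\<lambda>t. u 0 t ^ Suc m"])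
      (simp_all del: power_Suc)
  from lborel_integrable_real_affine[OF this, of k "- j"] assms show ?thesis by simp
qed

lemma integral_u_affine:
  assumes "k > 0" shows "(\<integral>t. u 0 (k * t - j) ^ m \<partial>lborel) = (\<integral>t. u 0 t ^ m \<partial>lborel) / k"
  using lborel_integral_real_affine[of k "\<lambda>t. u 0 t ^ m" "- j"] assms by (simp add: field_simps)

lemma cell_bump_measurable [measurable]: "cell_bump k (\<lambda>_. 0) J \<in> borel_measurable borel"
  unfolding cell_bump_def [abs_def] by measurable

lemma bump_sum_measurable [measurable]: "bump_sum k (\<lambda>_. 0) \<xi> \<in> borel_measurable borel"
  unfolding bump_sum_def [abs_def] by measurable

lemma cell_bump_support:
  fixes v :: "'a::euclidean_space"
  assumes "cell_bump k (\<lambda>_. 0) J v \<noteq> 0" "b \<in> Basis"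
  shows "real k * (v \<bullet> b) - real (J b) \<in> {0<..<1}"
proof (rule ccontr)
  assume "\<not> ?thesis"
  then have "u 0 (real k * (v \<bullet> b) - real (J b)) = 0" by (rule u_support)
  then show False using assms by (auto simp: cell_bump_def)
qed

lemma cell_bump_support_unit_cube:
  fixes v :: "'a::euclidean_space"
  assumes "cell_bump k (\<lambda>_. 0) J v \<noteq> 0" "J \<in> cells k"
  shows "v \<in> unit_cube"
  unfolding unit_cube_def mem_box
proof (intro ballI)
  fix b :: 'a assume b: "b \<in> Basis"
  then have "J b < k" using assms(2) by (auto simp: cells_def)
  then have J: "real (J b) + 1 \<le> real k" by linarith
  have "0 \<le> real k * (v \<bullet> b)" "real k * (v \<bullet> b) \<le> real k * 1"
    using cell_bump_support[OF assms(1) b] J unfolding greaterThanLessThan_iff by linarith+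
  moreover have "0 < real k" using J by linarith
  ultimately have "0 \<le> v \<bullet> b" "v \<bullet> b \<le> 1"
    by (simp_all only: mult_le_cancel_left_pos) (simp add: zero_le_mult_iff)
  then show "0 \<bullet> b \<le> v \<bullet> b \<and> v \<bullet> b \<le> One \<bullet> b"
    using b by simp
qed

text \<open>At a point where both are nonzero, k v_b - J_b lies strictly between 0 and 1 for both
  indices, which determines each integer J_b.\<close>

lemma cell_bump_disjoint:
  fixes v :: "'a::euclidean_space"
  assumes J: "J \<in> cells k" "J' \<in> cells k" "J \<noteq> J'"
  shows "cell_bump k (\<lambda>_. 0) J v * cell_bump k (\<lambda>_. 0) J' v = 0"
proof (rule ccontr)
  assume "\<not> ?thesis"
  then have nz: "cell_bump k (\<lambda>_. 0) J v \<noteq> 0" "cell_bump k (\<lambda>_. 0) J' v \<noteq> 0" by auto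
  have "J b = J' b" if "b \<in> Basis" for b
    using cell_bump_support[OF nz(1) that] cell_bump_support[OF nz(2) that] by auto
  with J show False by (auto simp: cells_def intro: PiE_ext)
qed

lemma integral_cell_bump_square:
  assumes "0 < k"
  shows "(\<integral>v. (cell_bump k (\<lambda>_. 0) J (v :: 'a::euclidean_space))\<^sup>2 \<partial>lborel)
    = ((\<integral>t. (u 0 t)\<^sup>2 \<partial>lborel) / real k) ^ DIM('a)"
proof -
  have "(\<integral>v. (cell_bump k (\<lambda>_. 0) J (v :: 'a))\<^sup>2 \<partial>lborel) =
      (\<integral>v. (\<Prod>b\<in>Basis. (u 0 (real k * (v \<bullet> b) - real (J b)))\<^sup>2) \<partial>lborel)"
    by (simp add: cell_bump_def prod_power_distrib)
  also have "\<dots> = (\<Prod>b\<in>Basis. \<integral>t. (u 0 (real k * t - real (J b)))\<^sup>2 \<partial>lborel)"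
    by (rule integral_lborel_prod) (use integrable_u_affine[of "real k" _ 1] assms in \<open>simp add: numeral_2_eq_2\<close>)
  also have "\<dots> = ((\<integral>t. (u 0 t)\<^sup>2 \<partial>lborel) / real k) ^ DIM('a)"
    using assms by (simp add: integral_u_affine)
  finally show ?thesis .
qed

text \<open>Separates x from z, so that integrals along the fibres over z can be computed. The
  restricted indices need not be extensional, hence not in \<open>cells k\<close>, but
  \<open>cell_bump\<close> reads them only on the basis.\<close>

lemma cell_bump_Pair:
  "cell_bump k (\<lambda>_. 0) J (x, z) =
    cell_bump k (\<lambda>_. 0) (\<lambda>b. J (b, 0)) x * cell_bump k (\<lambda>_. 0) (\<lambda>b. J (0, b)) z"
  unfolding cell_bump_def Basis_prod_def
  by (subst prod.union_disjoint) (auto simp: prod.reindex inj_on_def)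

lemma integral_cell_bump:
  assumes "0 < k"
  shows "(\<integral>v. cell_bump k (\<lambda>_. 0) J (v :: 'a::euclidean_space) \<partial>lborel) = 0"
proof -
  have "(\<integral>v. cell_bump k (\<lambda>_. 0) J (v :: 'a) \<partial>lborel) =
      (\<Prod>b\<in>(Basis :: 'a set). \<integral>t. u 0 (real k * t - real (J b)) \<partial>lborel)"
    unfolding cell_bump_def
    by (simp, rule integral_lborel_prod) (use integrable_u_affine[of "real k" _ 0] assms in simp)
  also have "\<dots> = 0"
    using integral_u_affine[of "real k" _ 1] assms u_integral by simp
  finally show ?thesis .
qed

lemma abs_cell_bump_le:
  assumes "J \<in> cells k"
  shows "\<bar>cell_bump k (\<lambda>_. 0) J (v :: 'a::euclidean_space)\<bar> \<le> K ^ DIM('a) * indicator unit_cube v"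
proof (cases "cell_bump k (\<lambda>_. 0) J v = 0")
  case False
  then have "v \<in> unit_cube" using assms by (rule cell_bump_support_unit_cube)
  moreover have "\<bar>cell_bump k (\<lambda>_. 0) J v\<bar> \<le> (\<Sum>J\<in>cells k. \<bar>cell_bump k (\<lambda>_. 0) J v\<bar>)"
    using assms by (intro member_le_sum) auto
  ultimately show ?thesis using sum_abs_cell_bump_le[of "\<lambda>_. 0" k v] by simp
qed (use K_ge_1 in auto)

lemma integrable_bounded_mult_cell_bump:
  assumes "J \<in> cells k" "f \<in> borel_measurable borel" "\<And>v. \<bar>f v\<bar> \<le> B"
  shows "integrable lborel (\<lambda>v :: 'a::euclidean_space. f v * cell_bump k (\<lambda>_. 0) J v)"
proof (rule Bochner_Integration.integrable_bound[of lborel "\<lambda>v. B * (K ^ DIM('a) * indicator unit_cube v)"])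
  show "integrable lborel (\<lambda>v :: 'a. B * (K ^ DIM('a) * indicator unit_cube v))"
    using emeasure_lborel_unit_cube[where 'a='a] by simp
  have "\<bar>f v * cell_bump k (\<lambda>_. 0) J v\<bar> \<le> \<bar>B * (K ^ DIM('a) * indicator unit_cube v)\<bar>" for v
    unfolding abs_mult by (intro mult_mono order_trans[OF assms(3) abs_ge_self]
      order_trans[OF abs_cell_bump_le[OF assms(1)] abs_ge_self[THEN order_trans]]) (simp_all add: abs_mult)
  then show "AE v in lborel. norm (f v * cell_bump k (\<lambda>_. 0) J v) \<le> norm (B * (K ^ DIM('a) * indicator unit_cube v))"
    by simp
qed (use assms(2) in measurable)

text \<open>For fixed z the indicator and the z-factor of a cell bump are constants, and the
  integral of the x-factor is zero. This provides the centring that makes m = 0.\<close>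

lemma integral_bump_sum_fibre:
  fixes \<xi> :: "('a::euclidean_space \<times> 'b::euclidean_space \<Rightarrow> nat) \<Rightarrow> real"
  assumes "0 < k" and B [measurable]: "B \<in> sets borel"
  shows "(\<integral>v. indicator B (snd v) * bump_sum k (\<lambda>_. 0) \<xi> v \<partial>uniform_cube) = 0"
proof -
  have [measurable]: "(snd :: 'a \<times> 'b \<Rightarrow> _) \<in> borel_measurable borel"
    by (intro borel_measurable_continuous_onI continuous_intros)
  define f :: "_ \<Rightarrow> 'a \<times> 'b \<Rightarrow> real" where "f J v = indicator B (snd v) * cell_bump k (\<lambda>_. 0) J v" for J v
  have int: "integrable lborel (f J)" if "J \<in> cells k" for J
    unfolding f_def [abs_def]
    by (rule integrable_bounded_mult_cell_bump[OF that, where B=1]) (auto simp: indicator_def)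
  have "(\<integral>v. f J v \<partial>lborel) = 0" if "J \<in> cells k" for J
  proof -
    have *: "integrable (lborel \<Otimes>\<^sub>M lborel) (\<lambda>(x, z). f J (x, z))"
      using int[OF that] by (simp add: lborel_prod)
    have "(\<integral>v. f J v \<partial>lborel) = (\<integral>z. (\<integral>x. f J (x, z) \<partial>lborel) \<partial>lborel)"
      using lborel_pair.integral_snd[OF *] by (simp add: lborel_prod)
    also have "\<dots> = 0"
      using integral_cell_bump[OF \<open>0 < k\<close>, where 'a='a] by (simp add: f_def cell_bump_Pair)
    finally show ?thesis .
  qed
  moreover have "indicator unit_cube v * (indicator B (snd v) * bump_sum k (\<lambda>_. 0) \<xi> v)
      = (\<Sum>J\<in>cells k. \<xi> J * f J v)" for v
    unfolding bump_sum_def f_def sum_distrib_left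
    by (intro sum.cong refl) (use cell_bump_support_unit_cube[of k _ v] in \<open>auto simp: indicator_def\<close>)
  ultimately show ?thesis
    using int by (subst integral_uniform_cube) (simp_all add: Bochner_Integration.integral_sum)
qed

text \<open>Disjoint supports remove the products of different cells, and all remaining squares have
  the same integral. The overlap is thus linear in the products of signs.\<close>

lemma integral_bump_sum_mult:
  fixes \<xi> \<xi>' :: "('a::euclidean_space \<Rightarrow> nat) \<Rightarrow> real"
  assumes "0 < k"
  shows "(\<integral>v. bump_sum k (\<lambda>_. 0) \<xi> v * bump_sum k (\<lambda>_. 0) \<xi>' v \<partial>uniform_cube) =
    ((\<integral>t. (u 0 t)\<^sup>2 \<partial>lborel) / real k) ^ DIM('a) * (\<Sum>J\<in>cells k. \<xi> J * \<xi>' J)"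
proof -
  let ?c = "cell_bump k (\<lambda>_. 0)"
  have int: "integrable lborel (\<lambda>v :: 'a. (?c J v)\<^sup>2)" if "J \<in> cells k" for J
  proof -
    have "\<bar>?c J v\<bar> \<le> K ^ DIM('a)" for v :: 'a
      using abs_cell_bump_le[OF that, of v] K_ge_1 by (cases "v \<in> unit_cube") auto
    from integrable_bounded_mult_cell_bump[OF that _ this] show ?thesis
      by (simp add: power2_eq_square)
  qed
  have "indicator unit_cube v * (bump_sum k (\<lambda>_. 0) \<xi> v * bump_sum k (\<lambda>_. 0) \<xi>' v)
      = (\<Sum>J\<in>cells k. \<xi> J * \<xi>' J * (?c J v)\<^sup>2)" for v
  proof -
    have "indicator unit_cube v * (bump_sum k (\<lambda>_. 0) \<xi> v * bump_sum k (\<lambda>_. 0) \<xi>' v) =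
        (\<Sum>J\<in>cells k. \<Sum>J'\<in>cells k. indicator unit_cube v * (\<xi> J * \<xi>' J' * (?c J v * ?c J' v)))"
      unfolding bump_sum_def by (subst sum_product) (simp add: sum_distrib_left mult_ac)
    also have "\<dots> = (\<Sum>J\<in>cells k. \<Sum>J'\<in>cells k. if J' = J then \<xi> J * \<xi>' J * (?c J v)\<^sup>2 else 0)"
      by (intro sum.cong refl)
        (use cell_bump_disjoint[of _ k _ v] cell_bump_support_unit_cube[of k _ v] in
          \<open>auto simp: indicator_def power2_eq_square\<close>)
    finally show ?thesis by simp
  qed
  then show ?thesis
    using int assms
    by (subst integral_uniform_cube)
      (simp_all add: Bochner_Integration.integral_sum integral_cell_bump_square sum_distrib_left sum_distrib_right mult.commute)
qed

lemma card_cells: "card (cells k :: ('a::euclidean_space \<Rightarrow> nat) set) = k ^ DIM('a)"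
  by (simp add: cells_def card_PiE)

end

section \<open>The lower bound\<close>

text \<open>The locale differentiates \<open>u j\<close> for all \<open>j \<le> r\<close>, hence up
  to order r + 1, and the polynomial bump allows M - 1 derivatives; therefore M = r + 2.\<close>

lemma exists_centred_bump: "\<exists>u K. centred_bump u K r \<and> 0 < (\<integral>t. (u 0 t)\<^sup>2 \<partial>lborel) \<and> (\<integral>t. (u 0 t)\<^sup>2 \<partial>lborel) \<le> 1"
proof -
  obtain K where K: "1 \<le> K" "\<And>j t. j \<le> Suc r \<Longrightarrow> \<bar>bump (r + 2) j t\<bar> \<le> K"
    using bump_bounded[of "Suc r" "r + 2"] by blast
  have "centred_bump (bump (r + 2)) K r"
    by unfold_locales
      (use K has_real_derivative_bump integral_bump_eq_0 in \<open>auto simp: bump_def[of _ _ t for t]\<close>)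
  then show ?thesis using integral_bump_square_pos integral_bump_square_le_1 by blast
qed

lemma null_law_in_model_class:
  assumes "1 \<le> C" "0 < c" "c \<le> 1"
  shows "(null_law :: ('dx::finite, 'dz::finite) obs measure) \<in> model_class s C c \<delta>"
    and "tau (null_law :: ('dx, 'dz) obs measure) = 0"
proof -
  interpret centred_regression_function "\<lambda>_ :: (real^'dx) \<times> (real^'dz). 0"
    by unfold_locales auto
  show "(null_law :: ('dx, 'dz) obs measure) \<in> model_class s C c \<delta>"
    using law_in_model_class[of C c s \<delta>] assms
      holder_space_const[of "\<lambda>_. 0" 0 C s] holder_norm_const[of "\<lambda>_. 0" 0 C s] by (simp add: law_0)
  show "tau (null_law :: ('dx, 'dz) obs measure) = 0"
    using tau_law by (simp add: law_0)
qed

text \<open>The first identity is the balance between sample size and mesh in the second moment; the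
  second turns the separation k^(-2s) into the rate.\<close>

lemma rate_exponent:
  fixes s d x :: real
  assumes "0 < s" "0 < d" "0 < n"
  shows "(real n powr (2 / (4 * s + d))) powr (4 * s + d) = (real n)\<^sup>2"
    and "(real n powr (2 / (4 * s + d))) powr (- 2 * s) = real n powr - (4 * s / (4 * s + d))"
proof -
  have "4 * s + d \<noteq> 0" using assms by linarith
  then have "2 / (4 * s + d) * (4 * s + d) = 2" "2 / (4 * s + d) * (- 2 * s) = - (4 * s / (4 * s + d))"
    by (simp_all add: field_simps)
  then show "(real n powr (2 / (4 * s + d))) powr (4 * s + d) = (real n)\<^sup>2"
    "(real n powr (2 / (4 * s + d))) powr (- 2 * s) = real n powr - (4 * s / (4 * s + d))"
    using \<open>0 < n\<close> by (simp_all only: powr_powr) simp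
qed

text \<open>The constant \<kappa> makes the Hoelder bound 2 d K^d \<rho> k^s equal to 1, which is at
  most C. The same choice gives |h| \<le> 1 and \<kappa> \<le> 1/2. The right-hand side of the
  condition on \<open>e\<close> is the separation achieved by the construction, freed of its power
  of n.\<close>

lemma (in centred_bump) exists_hard_alternative:
  fixes \<phi> :: "(nat \<Rightarrow> ('dx::finite, 'dz::finite) obs) \<Rightarrow> nat"
  defines "d \<equiv> CARD('dx) + CARD('dz)" and "A \<equiv> (\<integral>t. (u 0 t)\<^sup>2 \<partial>lborel)"
  defines "\<kappa> \<equiv> 1 / (2 * real d * K ^ d)"
  assumes A: "0 < A" "A \<le> 1" and s: "0 < s" "r = holder_order s"
    and C: "1 \<le> C" "0 < c" "c \<le> 1" and n: "0 < n"
    and e: "e * real n powr (4 * s / (4 * s + real d)) \<le> \<kappa>\<^sup>2 * A ^ d * 2 powr (- 2 * s)"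
    and \<phi>: "\<phi> \<in> Pi\<^sub>M {..<n} (\<lambda>_. borel) \<rightarrow>\<^sub>M count_space {0, 1}"
  shows "\<exists>P\<in>alternatives s C c \<delta> e. rejection_prob P n \<phi> \<le> rejection_prob null_law n \<phi> + 1 / 2"
proof -
  have d: "1 \<le> d" "DIM((real^'dx) \<times> (real^'dz)) = d"
    by (simp_all add: d_def Suc_leI)
  have K: "1 \<le> K ^ d" using K_ge_1 by simp
  have \<kappa>: "0 < \<kappa>" "\<kappa> * K ^ d * (2 * real d) = 1"
    using d K K_ge_1 by (auto simp: \<kappa>_def field_simps)
  \<comment> \<open>Needed for \<kappa>^4 \<le> 1/16 in the second moment bound.\<close>
  have "\<kappa> * (2 * 1 * 1) \<le> \<kappa> * (2 * real d * K ^ d)"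
    using \<kappa>(1) d K by (intro mult_left_mono mult_mono) auto
  also have "\<dots> = 1" using \<kappa>(2) by (simp add: mult_ac)
  finally have \<kappa>2: "\<kappa> \<le> 1 / 2" by simp
  define x where "x = real n powr (2 / (4 * s + real d))"
  have x: "1 \<le> x" using n s by (auto simp: x_def intro!: ge_one_powr_ge_zero)
  \<comment> \<open>Rounding up gives k \<ge> x, as the second moment requires. Since x \<ge> 1 it
    at most doubles x, and k \<le> 2x costs the separation only a factor 2^(-2s).\<close>
  define k where "k = nat \<lceil>x\<rceil>"
  have k: "x \<le> real k" "real k \<le> 2 * x" "0 < k"
    using x by (auto simp: k_def) linarith+
  define \<rho> where "\<rho> = \<kappa> * real k powr - s"
  have \<rho>: "0 < \<rho>" "\<rho> \<le> \<kappa>"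
  proof -
    show "0 < \<rho>" using \<kappa> k by (simp add: \<rho>_def)
    have "real k powr - s \<le> real k powr 0" using k s by (intro powr_mono) auto
    then show "\<rho> \<le> \<kappa>" using \<kappa> k by (simp add: \<rho>_def mult_left_le)
  qed
  let ?S = "cells k :: ((real^'dx) \<times> (real^'dz) \<Rightarrow> nat) set"
  define \<Xi> where "\<Xi> = (?S \<rightarrow>\<^sub>E {-1, 1::real})"
  define h where "h \<xi> = bump_sum k (\<lambda>_. 0) (\<lambda>J. \<rho> * \<xi> J)" for \<xi> :: "((real^'dx) \<times> (real^'dz) \<Rightarrow> nat) \<Rightarrow> real"
  \<comment> \<open>The integral of the square of a single scaled bump, hence what one cell
    contributes to an overlap.\<close>
  define \<mu> where "\<mu> = \<rho>\<^sup>2 * (A / real k) ^ d"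
  have \<xi>_abs: "\<bar>\<rho> * \<xi> J\<bar> \<le> \<rho>" if "\<xi> \<in> \<Xi>" "J \<in> ?S" for \<xi> J
    using PiE_mem[OF that[unfolded \<Xi>_def]] \<rho> by (auto simp: abs_mult)
  have h_le: "\<bar>h \<xi> v\<bar> \<le> 1" if "\<xi> \<in> \<Xi>" for \<xi> v
  proof -
    have "\<bar>h \<xi> v\<bar> \<le> \<rho> * K ^ d"
      unfolding h_def using abs_bump_sum_le[of "\<lambda>_. 0" k "\<lambda>J. \<rho> * \<xi> J" \<rho> v] \<xi>_abs[OF that] \<rho> d by simp
    also have "\<dots> \<le> \<kappa> * K ^ d * (2 * real d)"
      using \<rho> d K \<kappa> mult_mono[of "\<rho> * K ^ d" "\<kappa> * K ^ d" 1 "2 * real d"] by (simp add: mult_right_mono)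
    finally show ?thesis using \<kappa> by simp
  qed
  have h: "centred_regression_function (h \<xi>)" if "\<xi> \<in> \<Xi>" for \<xi>
    by unfold_locales (use h_le[OF that] integral_bump_sum_fibre[OF k(3)] in \<open>auto simp: h_def\<close>)
  have overlap: "(\<integral>v. h \<xi> v * h \<xi>' v \<partial>uniform_cube) = \<mu> * (\<Sum>J\<in>?S. \<xi> J * \<xi>' J)" for \<xi> \<xi>'
    unfolding h_def integral_bump_sum_mult[OF k(3)] \<mu>_def A_def[symmetric] d
    by (simp add: sum_distrib_left power2_eq_square mult_ac)
  have cardS: "card ?S = k ^ d" using card_cells[of k, where 'a="(real^'dx) \<times> (real^'dz)"] d by simp
  have "real (card ?S) * \<mu> = \<rho>\<^sup>2 * A ^ d" using k by (simp add: cardS \<mu>_def power_divide)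
  then have S\<mu>: "real (card ?S) * \<mu> = \<kappa>\<^sup>2 * A ^ d * real k powr (- 2 * s)"
    using k by (simp add: \<rho>_def power_mult_distrib powr_power mult_ac)
  have "A ^ d \<le> 1" using A by (intro power_le_one) auto
  have \<mu>0: "0 \<le> \<mu>" using A by (simp add: \<mu>_def)
  have "\<rho>\<^sup>2 * A ^ d \<le> 1 * 1"
    using \<rho> \<kappa>2 \<open>A ^ d \<le> 1\<close> A by (intro mult_mono) (auto intro!: power_le_one)
  then have \<mu>1: "real (card ?S) * \<mu> \<le> 1" using \<open>real (card ?S) * \<mu> = \<rho>\<^sup>2 * A ^ d\<close> by simp
  \<comment> \<open>Inserting \<rho> = \<kappa> k^(-s), the left-hand side is \<kappa>^4 A^(2d) n^2
    k^(-4s-d). As k \<ge> x, the factor n^2 k^(-4s-d) is at most 1.\<close>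
  have chi: "real (card ?S) * (real n * \<mu>)\<^sup>2 \<le> 1 / 16"
  proof -
    have "(real n)\<^sup>2 \<le> real k powr (4 * s + real d)"
      using rate_exponent(1)[of s "real d" n] powr_mono2[of "4 * s + real d" x "real k"] s d n x k
      by (simp add: x_def)
    then have nk: "(real n)\<^sup>2 * real k powr - (4 * s + real d) \<le> 1"
      unfolding powr_minus_divide using k by (simp add: divide_le_eq_1_pos)
    have "real (card ?S) * (real n * \<mu>)\<^sup>2 = (real n)\<^sup>2 * (\<rho> ^ 4 * ((A ^ d)\<^sup>2 * (1 / real k ^ d)))"
      using k by (simp add: cardS \<mu>_def power_divide power_mult_distrib field_simps power2_eq_square power4_eq_xxxx)
    also have "\<dots> = \<kappa> ^ 4 * (A ^ d)\<^sup>2 * ((real n)\<^sup>2 * (real k powr (- s * 4) * real k powr - real d))"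
    proof -
      have "\<rho> ^ 4 = \<kappa> ^ 4 * real k powr (- s * 4)"
        using k by (simp add: \<rho>_def power_mult_distrib powr_power mult.commute)
      moreover have "1 / real k ^ d = real k powr - real d"
        using k by (simp add: powr_minus_divide powr_realpow)
      ultimately show ?thesis by (simp only: mult_ac)
    qed
    also have "\<dots> = \<kappa> ^ 4 * (A ^ d)\<^sup>2 * ((real n)\<^sup>2 * real k powr - (4 * s + real d))"
      by (simp add: powr_add[symmetric] algebra_simps)
    also have "\<dots> \<le> (1 / 2) ^ 4 * 1 * 1"
      using nk \<kappa> \<kappa>2 A \<open>A ^ d \<le> 1\<close> by (intro mult_mono power_mono power_le_one) auto
    finally show ?thesis by (simp add: power4_eq_xxxx)
  qed
  have n\<mu>: "real n * \<mu> \<le> 1"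
  proof -
    \<comment> \<open>There is at least one cell, so \<open>chi\<close> bounds the square for a
      single cell as well.\<close>
    have "1 * (real n * \<mu>)\<^sup>2 \<le> real (card ?S) * (real n * \<mu>)\<^sup>2"
      using k by (intro mult_right_mono) (auto simp: cardS Suc_leI)
    with chi have "(real n * \<mu>)\<^sup>2 \<le> 1\<^sup>2" by simp
    then show ?thesis by (rule power2_le_imp_le) simp
  qed
  have "finite \<Xi>" "\<Xi> \<noteq> {}" by (auto simp: \<Xi>_def finite_PiE PiE_eq_empty_iff)
  moreover have "regression_function (h \<xi>)" if "\<xi> \<in> \<Xi>" for \<xi>
    using h[OF that] by (simp add: centred_regression_function_def)
  moreover have "(\<Sum>\<xi>\<in>\<Xi>. \<Sum>\<xi>'\<in>\<Xi>. (1 + (\<integral>v. h \<xi> v * h \<xi>' v \<partial>uniform_cube)) ^ n) \<le> (5 / 4) * (real (card \<Xi>))\<^sup>2"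
    unfolding overlap \<Xi>_def by (rule sum_sum_power_signs_le[OF finite_cells \<mu>0 \<mu>1 n\<mu> chi])
  ultimately obtain \<xi> where \<xi>: "\<xi> \<in> \<Xi>" "rejection_prob (law (h \<xi>)) n \<phi> \<le> rejection_prob null_law n \<phi> + 1 / 2"
    using exists_rejection_prob_le[of \<Xi> h \<phi> n] \<phi> by blast
  interpret centred_regression_function "h \<xi>" by (rule h[OF \<xi>(1)])
  have "2 * real DIM((real^'dx) \<times> (real^'dz)) * K ^ DIM((real^'dx) \<times> (real^'dz)) * \<rho> * real k powr s = 1"
  proof -
    have "\<rho> * real k powr s = \<kappa>" using k by (simp add: \<rho>_def powr_minus)
    moreover have "2 * real d * K ^ d * \<rho> * real k powr s = \<rho> * real k powr s * K ^ d * (2 * real d)"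
      by (simp only: mult_ac)
    ultimately show ?thesis unfolding d(2) using \<kappa>(2) by simp
  qed
  then have B: "2 * real DIM((real^'dx) \<times> (real^'dz)) * K ^ DIM((real^'dx) \<times> (real^'dz)) * \<rho> * real k powr s \<le> C"
    using C by simp
  have "h \<xi> \<in> holder_space s" "holder_norm s (h \<xi>) \<le> C"
    unfolding h_def
    by (rule bump_sum_in_holder_space[OF s _ \<xi>_abs[OF \<xi>(1)] \<rho>(1) B] holder_norm_bump_sum_le[OF s _ \<xi>_abs[OF \<xi>(1)] \<rho>(1) B];
      use k in simp)+
  then have "law (h \<xi>) \<in> model_class s C c \<delta>"
    using C by (intro law_in_model_class)
  moreover have "e \<le> tau (law (h \<xi>))"
  proof -
    \<comment> \<open>Squares of signs are 1, so every sign pattern has the same \<tau> and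
      whichever \<xi> was obtained is separated enough.\<close>
    have "(\<Sum>J\<in>?S. \<xi> J * \<xi> J) = (\<Sum>J\<in>?S. 1)"
      by (rule sum.cong) (use PiE_mem[OF \<xi>(1)[unfolded \<Xi>_def]] in force)+
    then have "tau (law (h \<xi>)) = real (card ?S) * \<mu>"
      using overlap[of \<xi> \<xi>] by (simp add: tau_law power2_eq_square)
    also have "\<dots> = \<kappa>\<^sup>2 * A ^ d * real k powr (- 2 * s)" by (rule S\<mu>)
    also have "\<dots> \<ge> \<kappa>\<^sup>2 * A ^ d * (2 * x) powr (- 2 * s)"
      using k x s A by (intro mult_left_mono powr_mono2') auto
    also have "\<kappa>\<^sup>2 * A ^ d * (2 * x) powr (- 2 * s) =
        \<kappa>\<^sup>2 * A ^ d * 2 powr (- 2 * s) * real n powr - (4 * s / (4 * s + real d))"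
      using rate_exponent(2)[of s "real d" n] s d n x by (simp add: x_def powr_mult)
    also have "\<dots> \<ge> e * real n powr (4 * s / (4 * s + real d)) * real n powr - (4 * s / (4 * s + real d))"
      by (intro mult_right_mono e) simp
    also have "e * real n powr (4 * s / (4 * s + real d)) * real n powr - (4 * s / (4 * s + real d)) = e"
      using n by (simp add: powr_minus)
    finally show ?thesis .
  qed
  ultimately show ?thesis using \<xi>(2) by (auto simp: alternatives_def)
qed

theorem proposition8:
  fixes s C c \<delta> \<alpha> :: real
  assumes "s > 0" and "C \<ge> 1" and "0 < c" and "c \<le> 1"
    and "0 < \<delta>" and "\<delta> \<le> 2" and "0 < \<alpha>" and "\<alpha> < 1 / 2"
  shows "\<exists>c'>0. \<forall>\<epsilon> :: nat \<Rightarrow> real. (\<forall>n. \<epsilon> n > 0) \<longrightarrow>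
     limsup (\<lambda>n. ereal (\<epsilon> n * real n powr (4 * s / (4 * s + real (CARD('dx) + CARD('dz)))))) < ereal c' \<longrightarrow>
     (\<forall>\<phi> :: nat \<Rightarrow> (nat \<Rightarrow> ('dx::finite, 'dz::finite) obs) \<Rightarrow> nat.
        is_test \<phi> \<longrightarrow> uniform_asymptotic_size_le (model_class s C c \<delta>) \<phi> \<alpha> \<longrightarrow>
        limsup (\<lambda>n. INF P\<in>alternatives s C c \<delta> (\<epsilon> n). ereal (rejection_prob P n (\<phi> n)))
          \<le> ereal (\<alpha> + 1 / 2))"
proof -
  obtain u K where "centred_bump u K (holder_order s)"
    and A: "0 < (\<integral>t. (u 0 t)\<^sup>2 \<partial>lborel)" "(\<integral>t. (u 0 t)\<^sup>2 \<partial>lborel) \<le> (1 :: real)"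
    using exists_centred_bump[of "holder_order s"] by blast
  then interpret centred_bump u K "holder_order s" by simp
  define d where "d = CARD('dx) + CARD('dz)"
  \<comment> \<open>This is \<kappa>^2 A^d 2^(-2s), the separation guaranteed by
    \<open>exists_hard_alternative\<close>; it depends only on s and the dimensions, through the
    chosen bump.\<close>
  define c' where "c' = (1 / (2 * real d * K ^ d))\<^sup>2 * (\<integral>t. (u 0 t)\<^sup>2 \<partial>lborel) ^ d * 2 powr (- 2 * s)"
  have "0 < d" by (simp add: d_def)
  then have "0 < c'" using A K_ge_1 by (auto simp: c'_def)
  moreover have "limsup (\<lambda>n. INF P\<in>alternatives s C c \<delta> (\<epsilon> n). ereal (rejection_prob P n (\<phi> n))) \<le> ereal (\<alpha> + 1 / 2)"
    if lim: "limsup (\<lambda>n. ereal (\<epsilon> n * real n powr (4 * s / (4 * s + real (CARD('dx) + CARD('dz)))))) < ereal c'"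
      and test: "is_test \<phi>" and size: "uniform_asymptotic_size_le (model_class s C c \<delta>) \<phi> \<alpha>"
    for \<epsilon> and \<phi> :: "nat \<Rightarrow> (nat \<Rightarrow> ('dx, 'dz) obs) \<Rightarrow> nat"
  proof (rule ereal_le_epsilon2, rule Limsup_bounded)
    \<comment> \<open>The size condition is asymptotic: it bounds the rejection probability of the
      null law by \<alpha> + \<eta> only for large n, and \<eta> is arbitrary. The strict bound on
      the other limsup likewise gives the condition on \<open>\<epsilon> n\<close> for large
      n.\<close>
    fix \<eta> :: real assume "0 < \<eta>"
    let ?null = "null_law :: ('dx, 'dz) obs measure"
    have "limsup (\<lambda>n. SUP P\<in>{P \<in> model_class s C c \<delta>. tau P = 0}. ereal (rejection_prob P n (\<phi> n))) < ereal (\<alpha> + \<eta>)"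
      by (rule le_less_trans[OF size[unfolded uniform_asymptotic_size_le_def]]) (use \<open>0 < \<eta>\<close> in simp)
    from Limsup_lessD[OF this] Limsup_lessD[OF lim] eventually_gt_at_top[of "0::nat"]
    show "\<forall>\<^sub>F n in sequentially. (INF P\<in>alternatives s C c \<delta> (\<epsilon> n). ereal (rejection_prob P n (\<phi> n)))
        \<le> ereal (\<alpha> + 1 / 2) + ereal \<eta>"
    proof eventually_elim
      case (elim n)
      have "ereal (rejection_prob ?null n (\<phi> n)) \<le> (SUP P\<in>{P \<in> model_class s C c \<delta>. tau P = 0}. ereal (rejection_prob P n (\<phi> n)))"
        using null_law_in_model_class assms by (intro SUP_upper) auto
      from le_less_trans[OF this elim(1)] have null: "rejection_prob ?null n (\<phi> n) \<le> \<alpha> + \<eta>"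
        by simp
      obtain P where P: "P \<in> alternatives s C c \<delta> (\<epsilon> n)"
        "rejection_prob P n (\<phi> n) \<le> rejection_prob ?null n (\<phi> n) + 1 / 2"
      proof -
        have "\<phi> n \<in> Pi\<^sub>M {..<n} (\<lambda>_. borel) \<rightarrow>\<^sub>M count_space {0, 1}"
          using test by (simp add: is_test_def)
        then have "\<exists>P\<in>alternatives s C c \<delta> (\<epsilon> n). rejection_prob P n (\<phi> n) \<le> rejection_prob ?null n (\<phi> n) + 1 / 2"
          using assms A elim by (intro exists_hard_alternative) (auto simp: c'_def d_def)
        then show ?thesis using that by blast
      qed
      have "(INF P\<in>alternatives s C c \<delta> (\<epsilon> n). ereal (rejection_prob P n (\<phi> n))) \<le> ereal (rejection_prob P n (\<phi> n))"
        using P(1) by (rule INF_lower)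
      also have "\<dots> \<le> ereal (\<alpha> + 1 / 2) + ereal \<eta>" using P(2) null by simp
      finally show ?case .
    qed
  qed
  ultimately show ?thesis by blast
qed

end
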